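(* The Perron numbers $\frac{1+\sqrt5}{2}$, $1+\sqrt2$, $\frac{1+\sqrt{13}}{2}$, $\frac{1+\sqrt{17}}{2}$ are the only quadratic Perron numbers smaller than $3$ having property (CFF). Moreover, if Mercat's Conjecture holds, then they are the only quadratic Perron numbers with property (CFF).
   Context: A quadratic Perron number is an algebraic integer $\beta>1$ of degree 2 whose algebraic conjugate $\beta'$ satisfies $|\beta'|<\beta$. Mercat's Conjecture: every real quadratic field contains an element whose regular (classical, simple) continued fraction expansion is periodic with all partial quotients equal to 1 or 2. $\beta$-integers: for real $\beta>1$, every real $x\ge 0$ has a unique (up to leading zeros) greedy $\beta$-expansion $x=\sum_{i=-\infty}^{k}x_i\beta^i$ with integer digits $0\le x_i<\beta$ such that $\sum_{i=-\infty}^{j}x_i\beta^i<\beta^{j+1}$ for every $j\le k$. The set $\mathbb{Z}_\beta$ of $\beta$-integers consists of all real $x$ such that the greedy $\beta$-expansion of $|x|$ has $x_i=0$ for all $i<0$. $\beta$-continued fraction of $\xi\in\mathbb{R}$: put $\xi_0=\xi$ and, for $n\ge 0$, $a_n=\max\{y\in\mathbb{Z}_\beta: y\le \xi_n\}$; if $\xi_n\in\mathbb{Z}_\beta$ the algorithm stops and the expansion $[a_0,\dots,a_n]$ is finite; otherwise $\xi_{n+1}=1/(\xi_n-a_n)$. If it never stops, the expansion is the infinite sequence $[a_0,a_1,\dotsc]$. Property (CFF) of $\beta$: every element of $\mathbb{Q}(\beta)$ has a finite $\beta$-continued fraction expansion. *)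

theory Defs
  imports "HOL-Analysis.Analysis" "HOL-Computational_Algebra.Computational_Algebra"
begin

definition real_subfield :: "real set \<Rightarrow> bool" where
  "real_subfield K \<longleftrightarrow> 0 \<in> K \<and> 1 \<in> K \<and>
     (\<forall>x\<in>K. \<forall>y\<in>K. x + y \<in> K \<and> x * y \<in> K) \<and> (\<forall>x\<in>K. - x \<in> K \<and> inverse x \<in> K)"

definition rat_adjoin :: "real \<Rightarrow> real set" where
  "rat_adjoin \<beta> = real_subfield hull {\<beta>}"

interpretation rat_real: vector_space "\<lambda>(q::rat) (x::real). of_rat q * x"
  by unfold_locales (simp_all add: algebra_simps of_rat_add of_rat_mult)

text \<open>Infinite-dimensional spaces get \<^const>\<open>rat_real.dim\<close> 0, so the condition below does
  express that the degree over the rationals is 2.\<close>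

definition real_quadratic_field :: "real set \<Rightarrow> bool" where
  "real_quadratic_field K \<longleftrightarrow> real_subfield K \<and> rat_real.dim K = 2"

definition is_min_poly :: "rat poly \<Rightarrow> real \<Rightarrow> bool" where
  "is_min_poly p x \<longleftrightarrow> lead_coeff p = 1 \<and> irreducible p \<and> poly (map_poly of_rat p) x = 0"

text \<open>The conjugate \<open>\<beta>'\<close> is the second root of the minimal polynomial; it is real because
  \<open>\<beta>\<close> and the coefficients are.\<close>

definition quadratic_Perron :: "real \<Rightarrow> bool" where
  "quadratic_Perron \<beta> \<longleftrightarrow> \<beta> > 1 \<and> algebraic_int \<beta> \<and>
     (\<exists>p \<beta>'. is_min_poly p \<beta> \<and> degree p = 2 \<and>
        poly (map_poly of_rat p) \<beta>' = 0 \<and> \<beta>' \<noteq> \<beta> \<and> \<bar>\<beta>'\<bar> < \<beta>)"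

text \<open>The digit sequence is indexed by all integers, with zeros above the leading position \<open>k\<close>,
  so that it is unique although \<open>k\<close> is not.\<close>

definition greedy_expansion :: "real \<Rightarrow> real \<Rightarrow> (int \<Rightarrow> int) \<Rightarrow> bool" where
  "greedy_expansion \<beta> x d \<longleftrightarrow>
     (\<forall>i. 0 \<le> d i \<and> real_of_int (d i) < \<beta>) \<and>
     (\<exists>k. (\<forall>i>k. d i = 0) \<and>
          ((\<lambda>i. real_of_int (d i) * \<beta> powi i) has_sum x) {..k} \<and>
          (\<forall>j\<le>k. (\<Sum>\<^sub>\<infinity>i\<in>{..j}. real_of_int (d i) * \<beta> powi i) < \<beta> powi (j + 1)))"

definition beta_integers :: "real \<Rightarrow> real set" where
  "beta_integers \<beta> = {x. \<exists>d. greedy_expansion \<beta> \<bar>x\<bar> d \<and> (\<forall>i<0. d i = 0)}"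

definition beta_floor :: "real \<Rightarrow> real \<Rightarrow> real" where
  "beta_floor \<beta> x = (GREATEST y. y \<in> beta_integers \<beta> \<and> y \<le> x)"

text \<open>The recursion does not stop by itself. The values \<open>\<xi>\<^sub>n\<close> are those of the algorithm up to the
  first index with \<open>\<xi>\<^sub>n\<close> a \<open>\<beta>\<close>-integer, and such an index exists iff the expansion is finite.\<close>

fun beta_cf_quotient :: "real \<Rightarrow> real \<Rightarrow> nat \<Rightarrow> real" where
  "beta_cf_quotient \<beta> \<xi> 0 = \<xi>"
| "beta_cf_quotient \<beta> \<xi> (Suc n) =
     1 / (beta_cf_quotient \<beta> \<xi> n - beta_floor \<beta> (beta_cf_quotient \<beta> \<xi> n))"

definition finite_beta_cf :: "real \<Rightarrow> real \<Rightarrow> bool" where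
  "finite_beta_cf \<beta> \<xi> \<longleftrightarrow> (\<exists>n. beta_cf_quotient \<beta> \<xi> n \<in> beta_integers \<beta>)"

definition CFF :: "real \<Rightarrow> bool" where
  "CFF \<beta> \<longleftrightarrow> (\<forall>\<xi>\<in>rat_adjoin \<beta>. finite_beta_cf \<beta> \<xi>)"

fun regular_cf_quotient :: "real \<Rightarrow> nat \<Rightarrow> real" where
  "regular_cf_quotient x 0 = x"
| "regular_cf_quotient x (Suc n) = 1 / (regular_cf_quotient x n - of_int \<lfloor>regular_cf_quotient x n\<rfloor>)"

definition partial_quotient :: "real \<Rightarrow> nat \<Rightarrow> int" where
  "partial_quotient x n = \<lfloor>regular_cf_quotient x n\<rfloor>"

definition infinite_regular_cf :: "real \<Rightarrow> bool" where
  "infinite_regular_cf x \<longleftrightarrow> (\<forall>n. regular_cf_quotient x n \<notin> \<int>)"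

text \<open>Periodic means purely periodic here. Allowing a preperiod would give an equivalent
  statement, since every complete quotient of \<open>x\<close> lies in the same field as \<open>x\<close>.\<close>

definition Mercat_conjecture :: bool where
  "Mercat_conjecture \<longleftrightarrow>
     (\<forall>K. real_quadratic_field K \<longrightarrow>
        (\<exists>x\<in>K. infinite_regular_cf x \<and>
           (\<exists>p>0. \<forall>n. partial_quotient x (n + p) = partial_quotient x n) \<and>
           (\<forall>n. partial_quotient x n \<in> {1, 2})))"

end

theory Submission
  imports Defs
begin

text \<open>
  A quadratic Perron number \<open>\<beta>\<close> is an irrational root of \<open>X\<^sup>2 - a X - b\<close> with integers \<open>a\<close>, \<open>b\<close> and
  conjugate \<open>\<beta>' = a - \<beta>\<close>, \<open>\<bar>\<beta>'\<bar> < \<beta>\<close>. Everything rests on a criterion that no longer mentions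
  \<open>\<beta>\<close>-integers (\<open>CFF_iff\<close>): \<open>\<beta>\<close> has property (CFF) iff \<open>\<rat>(\<beta>)\<close> contains no \<open>x > 1\<close> with infinite regular
  continued fraction all of whose complete quotients are smaller than \<open>\<beta>\<close>.

  For such an \<open>x\<close> the \<open>\<beta>\<close>-continued fraction is the regular one, because the nonnegative \<open>\<beta>\<close>-integers
  below \<open>\<beta>\<close> are just the integers \<open>0, \<dots>, \<lfloor>\<beta>\<rfloor>\<close>. Conversely, a \<open>\<beta>\<close>-integer \<open>y\<close> is either such an integer up
  to sign or satisfies \<open>\<bar>y'\<bar> \<le> c \<bar>y\<bar>\<close> with a constant \<open>c < 1\<close> (\<open>conjugate_of_beta_integer\<close>). The Euclidean
  algorithm in \<open>\<int>[\<beta>]\<close> behind an infinite \<open>\<beta>\<close>-continued fraction produces nonzero elements whose norms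
  would tend to 0 if partial quotients of the second kind occurred infinitely often
  (\<open>conjugates_not_infinitely_often_small\<close>). So from some point on all partial quotients are integers
  below \<open>\<beta>\<close>, and the tail of the expansion is a regular continued fraction of the forbidden type.

  For the four numbers in the statement, complete quotients below \<open>\<beta>\<close> force the partial quotients to
  be eventually all 1 or, for \<open>(1 + \<surd>17) / 2\<close>, all 2. The value \<open>(1 + \<surd>5) / 2\<close> or \<open>1 + \<surd>2\<close> of the tail
  then is not in \<open>\<rat>(\<beta>)\<close> or, for \<open>\<beta> = (1 + \<surd>5) / 2\<close>, not smaller than \<open>\<beta>\<close>. Only three other quadratic
  Perron numbers are smaller than 3, namely \<open>(3 + \<surd>5) / 2\<close>, \<open>1 + \<surd>3\<close> and \<open>(1 + \<surd>21) / 2\<close>; explicit periodic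
  continued fractions with digits 1 and 2 show that they fail. A number greater than 3 fails as soon
  as its field contains any continued fraction with digits 1 and 2, which is what Mercat's
  conjecture provides.
\<close>

section \<open>Regular continued fractions with bounded quotients\<close>

text \<open>Each term is controlled by the next one, so boundedness propagates back to the first term with
  an arbitrarily small factor.\<close>

lemma eq_0_if_backward_contracting:
  fixes e :: "nat \<Rightarrow> real"
  assumes k: "0 \<le> k" "k < 1"
    and step: "\<And>n. \<bar>e n\<bar> \<le> k * \<bar>e (Suc n)\<bar>" and bound: "\<And>n. \<bar>e n\<bar> \<le> B"
  shows "e 0 = 0"
proof -
  have iter: "\<bar>e m\<bar> \<le> k ^ n * \<bar>e (m + n)\<bar>" for m n
  proof (induction n arbitrary: m)
    case (Suc n)
    have "\<bar>e m\<bar> \<le> k * \<bar>e (Suc m)\<bar>" by (rule step)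
    also have "\<dots> \<le> k * (k ^ n * \<bar>e (Suc m + n)\<bar>)"
      using Suc[of "Suc m"] k by (intro mult_left_mono) auto
    finally show ?case by simp
  qed simp
  have le: "\<bar>e 0\<bar> \<le> k ^ n * B" for n
  proof -
    have "k ^ n * \<bar>e (0 + n)\<bar> \<le> k ^ n * B"
      using bound k by (intro mult_left_mono) auto
    with iter[of 0 n] show ?thesis by simp
  qed
  have "(\<lambda>n. k ^ n * B) \<longlonglongrightarrow> 0 * B"
    using k by (intro tendsto_mult tendsto_const LIMSEQ_realpow_zero) auto
  from LIMSEQ_le_const[OF this, of "\<bar>e 0\<bar>"] le show ?thesis by auto
qed

lemma regular_cf_quotient_shift:
  "regular_cf_quotient (regular_cf_quotient x m) n = regular_cf_quotient x (m + n)"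
  by (induction n) simp_all

lemma regular_cf_step:
  assumes "infinite_regular_cf x"
  shows "regular_cf_quotient x n = of_int (partial_quotient x n) + 1 / regular_cf_quotient x (Suc n)"
    and "1 < regular_cf_quotient x (Suc n)"
proof -
  define y where "y = regular_cf_quotient x n"
  have y: "y \<notin> \<int>" using assms by (simp add: infinite_regular_cf_def y_def)
  have "of_int \<lfloor>y\<rfloor> \<noteq> y" using y Ints_of_int by metis
  then have pos: "0 < y - of_int \<lfloor>y\<rfloor>" using of_int_floor_le[of y] by linarith
  have lt: "y - of_int \<lfloor>y\<rfloor> < 1" by linarith
  show "regular_cf_quotient x n = of_int (partial_quotient x n) + 1 / regular_cf_quotient x (Suc n)"
    by (simp add: partial_quotient_def)
  show "1 < regular_cf_quotient x (Suc n)"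
    using pos lt by (simp add: y_def[symmetric])
qed

lemma regular_cf_quotient_gt_1:
  assumes "infinite_regular_cf x" "1 < x"
  shows "1 < regular_cf_quotient x n"
  using assms regular_cf_step(2)[OF assms(1)] by (cases n) auto

lemma partial_quotient_ge_1:
  assumes "infinite_regular_cf x" "1 < x"
  shows "1 \<le> partial_quotient x n"
  using regular_cf_quotient_gt_1[OF assms, of n] by (simp add: partial_quotient_def)

lemma infinite_regular_cf_shift:
  assumes "infinite_regular_cf x"
  shows "infinite_regular_cf (regular_cf_quotient x n)"
  using assms by (auto simp: infinite_regular_cf_def regular_cf_quotient_shift)

text \<open>Writing \<open>t\<close> for the claimed value, \<open>x\<^sub>n - t = - (x\<^sub>n\<^sub>+\<^sub>1 - t) / (x\<^sub>n\<^sub>+\<^sub>1 t)\<close>, so bounded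
  complete quotients are squeezed to \<open>t\<close> from the far end of the expansion.\<close>

lemma constant_cf_value:
  fixes x :: "nat \<Rightarrow> real"
  assumes c: "1 \<le> c" and step: "\<And>n. x n = c + 1 / x (Suc n)"
    and gt1: "\<And>n. 1 < x n" and bound: "\<And>n. x n < B"
  shows "x 0 = (c + sqrt (c\<^sup>2 + 4)) / 2"
proof -
  define r where "r = sqrt (c\<^sup>2 + 4)"
  define t where "t = (c + r) / 2"
  have s: "r * r = c * c + 4" by (simp add: r_def power2_eq_square)
  have "1 < r" unfolding r_def by (rule real_less_rsqrt, unfold power_one) (use zero_le_power2[of c] in linarith)
  then have t1: "1 < t" using c by (simp add: t_def)
  have "t * t = c * t + 1" using s by (simp add: t_def field_simps)
  then have t: "t = c + 1 / t" using t1 by (simp add: field_simps)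
  have "x 0 - t = 0"
  proof (rule eq_0_if_backward_contracting[where e = "\<lambda>n. x n - t" and k = "1 / t" and B = "B + t"])
    fix n
    have "x n - t = 1 / x (Suc n) - 1 / t" using step[of n] t by linarith
    also have "\<dots> = - ((x (Suc n) - t) / (x (Suc n) * t))"
      using gt1[of "Suc n"] t1 by (simp add: field_simps)
    finally have "\<bar>x n - t\<bar> = \<bar>x (Suc n) - t\<bar> / (x (Suc n) * t)"
      using gt1[of "Suc n"] t1 by (simp add: abs_mult)
    also have "\<dots> \<le> \<bar>x (Suc n) - t\<bar> / t"
      using gt1[of "Suc n"] t1 by (intro divide_left_mono) auto
    finally show "\<bar>x n - t\<bar> \<le> 1 / t * \<bar>x (Suc n) - t\<bar>" by simp
    show "\<bar>x n - t\<bar> \<le> B + t" using gt1[of n] bound[of n] t1 by auto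
  qed (use t1 in auto)
  then show ?thesis by (simp add: t_def r_def)
qed

text \<open>Two steps of the expansion give \<open>x\<^sub>n \<le> 3 - 1 / (x\<^sub>n\<^sub>+\<^sub>2 + 1)\<close>. The right-hand side is a
  contraction in \<open>x\<^sub>n\<^sub>+\<^sub>2\<close> with fixed point \<open>1 + \<surd>3\<close>, the value of \<open>[2,1,2,1,\<dots>]\<close>.\<close>

lemma cf12_le_1_plus_sqrt3:
  assumes x: "infinite_regular_cf x" "1 < x" and digits: "\<And>n. partial_quotient x n \<in> {1, 2}"
  shows "x \<le> 1 + sqrt 3"
proof -
  define q where "q = regular_cf_quotient x"
  define s where "s = sqrt 3"
  have s: "s * s = 3" "1 < s" by (simp_all add: s_def real_less_rsqrt)
  have step: "q n = of_int (partial_quotient x n) + 1 / q (Suc n)" for n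
    unfolding q_def by (rule regular_cf_step(1)[OF x(1)])
  have gt1: "1 < q n" for n unfolding q_def by (rule regular_cf_quotient_gt_1[OF x])
  have inv_lt: "1 / q n < 1" for n using gt1[of n] by simp
  have bound: "q n < 3" for n
    using step[of n] inv_lt[of "Suc n"] digits[of n] by auto
  have le: "q n - (1 + s) \<le> max 0 (q (n + 2) - (1 + s)) / 2" for n
  proof -
    have "1 + 1 / q (n + 2) \<le> q (Suc n)" using step[of "Suc n"] digits[of "Suc n"] by auto
    then have "1 / q (Suc n) \<le> 1 / (1 + 1 / q (n + 2))"
      using gt1[of "n + 2"] by (intro divide_left_mono) (auto intro!: add_pos_pos mult_pos_pos gt1[THEN less_trans[OF zero_less_one]])
    also have "\<dots> = 1 - 1 / (q (n + 2) + 1)"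
      using gt1[of "n + 2"] by (simp add: field_simps)
    finally have a: "q n \<le> 3 - 1 / (q (n + 2) + 1)" using step[of n] digits[of n] by auto
    have b: "1 + s = 3 - 1 / (2 + s)" using s by (simp add: field_simps)
    have c: "1 / (2 + s) - 1 / (q (n + 2) + 1) = (q (n + 2) - (1 + s)) / ((2 + s) * (q (n + 2) + 1))"
      using s gt1[of "n + 2"] by (simp add: field_simps)
    have d: "(q (n + 2) - (1 + s)) / ((2 + s) * (q (n + 2) + 1)) \<le> max 0 (q (n + 2) - (1 + s)) / 2"
    proof (rule frac_le)
      have "1 * 2 \<le> (2 + s) * (q (n + 2) + 1)"
        using s gt1[of "n + 2"] by (intro mult_mono) auto
      then show "2 \<le> (2 + s) * (q (n + 2) + 1)" by simp
    qed auto
    from a b c d show ?thesis by linarith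
  qed
  have "max 0 (q (2 * 0) - (1 + s)) = 0"
  proof (rule eq_0_if_backward_contracting[where e = "\<lambda>n. max 0 (q (2 * n) - (1 + s))"
        and k = "1 / 2" and B = 3])
    fix n
    show "\<bar>max 0 (q (2 * n) - (1 + s))\<bar> \<le> 1 / 2 * \<bar>max 0 (q (2 * Suc n) - (1 + s))\<bar>"
      using le[of "2 * n"] by (simp add: max_def split: if_splits)
    show "\<bar>max 0 (q (2 * n) - (1 + s))\<bar> \<le> 3" using bound[of "2 * n"] s by simp
  qed auto
  then show ?thesis by (simp add: q_def s_def)
qed

text \<open>For verifying an explicit periodic expansion without computing its complete quotients: they
  cannot leave a set that is closed under stripping a leading digit.\<close>

lemma cf12_of_closed_set:
  assumes closed: "\<And>y. y \<in> S \<Longrightarrow> \<exists>a\<in>{1, 2::int}. \<exists>z\<in>S. 1 < z \<and> y = of_int a + 1 / z"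
    and x: "x \<in> S"
  shows "regular_cf_quotient x n \<in> S" "infinite_regular_cf x" "partial_quotient x n \<in> {1, 2}"
proof -
  have *: "y \<notin> \<int> \<and> \<lfloor>y\<rfloor> \<in> {1, 2} \<and> 1 / (y - of_int \<lfloor>y\<rfloor>) \<in> S" if "y \<in> S" for y
  proof -
    obtain a z where az: "a \<in> {1, 2::int}" "z \<in> S" "1 < z" "y = of_int a + 1 / z"
      using closed[OF \<open>y \<in> S\<close>] by blast
    have z: "0 < 1 / z" "1 / z < 1" using az(3) by auto
    have fl: "\<lfloor>y\<rfloor> = a" using az(4) z by (intro floor_unique) auto
    have "y \<noteq> of_int \<lfloor>y\<rfloor>" using fl az(4) z by auto
    then have "y \<notin> \<int>" using Ints_cases by (metis floor_of_int)
    then show ?thesis using fl az by simp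
  qed
  have inS: "regular_cf_quotient x n \<in> S" for n
    by (induction n) (use x * in auto)
  then show "regular_cf_quotient x n \<in> S" .
  show "infinite_regular_cf x" using inS * by (auto simp: infinite_regular_cf_def)
  show "partial_quotient x n \<in> {1, 2}" using inS * unfolding partial_quotient_def by blast
qed

definition cf_prepend :: "int list \<Rightarrow> real \<Rightarrow> real" where
  "cf_prepend w x = foldr (\<lambda>a y. of_int a + 1 / y) w x"

lemma cf_prepend_simps [simp]:
  "cf_prepend [] x = x" "cf_prepend (a # w) x = of_int a + 1 / cf_prepend w x"
  by (simp_all add: cf_prepend_def)

lemma cf_prepend_gt_1:
  assumes "1 < x" "set w \<subseteq> {1, 2}" shows "1 < cf_prepend w x"
  using assms(2)
proof (induction w)
  case (Cons a w)
  then have "0 < 1 / cf_prepend w x" "1 \<le> real_of_int a" by auto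
  then show ?case by (simp only: cf_prepend_simps)
qed (use assms in simp)

text \<open>Prepending the digits of a word acts as a Moebius transformation, whose coefficients can be
  computed without nested fractions.\<close>

fun cf_matrix :: "int list \<Rightarrow> int \<times> int \<times> int \<times> int" where
  "cf_matrix [] = (1, 0, 0, 1)"
| "cf_matrix (c # w) = (case cf_matrix w of (p, q, r, s) \<Rightarrow> (c * p + r, c * q + s, p, q))"

lemma cf_prepend_cf_matrix:
  assumes x: "0 < x" and w: "set w \<subseteq> {1, 2}" and M: "cf_matrix w = (p, q, r, s)"
  shows "0 < of_int p * x + of_int q \<and> 0 < of_int r * x + of_int s \<and>
    cf_prepend w x = (of_int p * x + of_int q) / (of_int r * x + of_int s)"
  using w M
proof (induction w arbitrary: p q r s)
  case (Cons c w)
  obtain p' q' r' s' where M': "cf_matrix w = (p', q', r', s')" by (metis prod_cases4)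
  have eqs: "p = c * p' + r'" "q = c * q' + s'" "r = p'" "s = q'" using Cons.prems M' by auto
  define A where "A = of_int p' * x + of_int q'"
  define B where "B = of_int r' * x + of_int s'"
  have IH: "0 < A" "0 < B" "cf_prepend w x = A / B"
    using Cons.IH[OF _ M'] Cons.prems by (auto simp: A_def B_def)
  have num: "of_int p * x + of_int q = of_int c * A + B" by (simp add: eqs A_def B_def algebra_simps)
  have den: "of_int r * x + of_int s = A" by (simp add: eqs A_def)
  have "0 < of_int c * A + B" using Cons.prems IH(1,2) by auto
  then show ?case unfolding num den using IH(1,2) by (simp add: IH(3) add_divide_distrib)
qed (use x in auto)

lemma periodic_cf12:
  assumes x: "1 < x" "cf_prepend w x = x" and w: "w \<noteq> []" "set w \<subseteq> {1, 2}"
  shows "infinite_regular_cf x" "partial_quotient x n \<in> {1, 2}"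
    "\<exists>v. set v \<subseteq> {1, 2} \<and> regular_cf_quotient x n = cf_prepend v x"
proof -
  define S where "S = {cf_prepend v x | v. v \<noteq> [] \<and> (\<exists>u. w = u @ v)}"
  have xS: "x \<in> S" unfolding S_def using x w by (metis (mono_tags, lifting) append_Nil mem_Collect_eq)
  have closed: "\<exists>a\<in>{1, 2::int}. \<exists>z\<in>S. 1 < z \<and> y = of_int a + 1 / z" if "y \<in> S" for y
  proof -
    obtain v u where v: "y = cf_prepend v x" "v \<noteq> []" "w = u @ v" using \<open>y \<in> S\<close> S_def by blast
    then obtain a v' where av: "v = a # v'" by (cases v) auto
    have "cf_prepend v' x \<in> S"
    proof (cases "v' = []")
      case False
      moreover have "w = (u @ [a]) @ v'" using v av by simp
      ultimately show ?thesis unfolding S_def by blast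
    qed (use xS in simp)
    moreover have "1 < cf_prepend v' x" using cf_prepend_gt_1[OF x(1)] w v av by simp
    moreover have "a \<in> {1, 2}" using w v av by simp
    ultimately show ?thesis using v av by (auto intro!: bexI[of _ a] bexI[of _ "cf_prepend v' x"])
  qed
  note * = cf12_of_closed_set[of S, OF closed xS]
  show "infinite_regular_cf x" "partial_quotient x n \<in> {1, 2}" using * by auto
  from *(1)[of n] obtain v u where "regular_cf_quotient x n = cf_prepend v x" "w = u @ v"
    unfolding S_def by blast
  then show "\<exists>v. set v \<subseteq> {1, 2} \<and> regular_cf_quotient x n = cf_prepend v x" using w by auto
qed

text \<open>The set \<open>{1 + \<surd>3, (1 + \<surd>3) / 2}\<close> of complete quotients of \<open>[2,1,2,1,\<dots>]\<close> is closed under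
  removing digits, hence a number outside it cannot reach it by prepending digits.\<close>

lemma cf_prepend_eq_1_plus_sqrt3:
  assumes x: "1 < x" and w: "set w \<subseteq> {1, 2}"
    and eq: "cf_prepend w x \<in> {1 + sqrt 3, (1 + sqrt 3) / 2}"
  shows "x \<in> {1 + sqrt 3, (1 + sqrt 3) / 2}"
  using w eq
proof (induction w)
  case (Cons a w)
  define s where "s = sqrt 3"
  define z where "z = cf_prepend w x"
  have s: "s * s = 3" "1 < s" "s < 2" by (simp_all add: s_def real_less_rsqrt real_less_lsqrt)
  have z: "1 < z" using cf_prepend_gt_1[OF x, of w] Cons.prems by (simp add: z_def)
  then have iz: "0 < 1 / z" "1 / z < 1" by auto
  have a: "a = 1 \<or> a = 2" using Cons.prems by auto
  consider "of_int a + 1 / z = 1 + s" | "of_int a + 1 / z = (1 + s) / 2"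
    using Cons.prems by (auto simp: z_def s_def)
  then have "z = 1 + s \<or> z = (1 + s) / 2"
  proof cases
    case 1
    have "a \<noteq> 1" using 1 iz s by auto
    then have "a = 2" using a by simp
    then have "1 / z = s - 1" using 1 by simp
    then have "1 / (1 / z) = 1 / (s - 1)" by (rule arg_cong)
    then have "z = 1 / (s - 1)" by simp
    also have "1 / (s - 1) = (1 + s) / 2" using s by (simp add: field_simps)
    finally have "z = (1 + s) / 2" .
    then show ?thesis by simp
  next
    case 2
    have "a \<noteq> 2"
    proof
      assume "a = 2"
      with 2 have "1 / z = (s - 3) / 2" by (simp add: field_simps)
      with iz(1) have "0 < (s - 3) / 2" by simp
      then show False using s(3) by simp
    qed
    then have "a = 1" using a by simp
    then have "1 / z = (s - 1) / 2" using 2 by (simp add: field_simps)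
    then have "1 / (1 / z) = 1 / ((s - 1) / 2)" by (rule arg_cong)
    then have "z = 2 / (s - 1)" by simp
    also have "2 / (s - 1) = 1 + s" using s by (simp add: field_simps)
    finally have "z = 1 + s" .
    then show ?thesis by simp
  qed
  then show ?case using Cons by (auto simp: z_def s_def)
qed simp

section \<open>Quadratic Perron numbers as roots of integer quadratics\<close>

lemma map_poly_of_int_rat_hom:
  "map_poly (of_int :: int \<Rightarrow> rat) (p * q) = map_poly of_int p * map_poly of_int q"
  "map_poly (of_int :: int \<Rightarrow> rat) (smult c p) = smult (of_int c) (map_poly of_int p)"
  by (rule poly_eqI, simp add: coeff_map_poly coeff_mult)+

lemma map_poly_of_rat_hom:
  "map_poly (of_rat :: rat \<Rightarrow> real) (p * q) = map_poly of_rat p * map_poly of_rat q"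
  "map_poly (of_rat :: rat \<Rightarrow> real) (p + q) = map_poly of_rat p + map_poly of_rat q"
  by (rule poly_eqI, simp add: coeff_map_poly coeff_mult of_rat_sum of_rat_mult of_rat_add)+

lemma poly_map_poly_of_rat:
  "poly (map_poly (of_rat :: rat \<Rightarrow> real) p) (of_rat t) = of_rat (poly p t)"
  by (induction p) (simp_all add: map_poly_pCons of_rat_add of_rat_mult)

lemma rat_poly_eq_primitive_int_poly:
  fixes p :: "rat poly"
  assumes "p \<noteq> 0"
  obtains c P where "content P = 1" "p = smult c (map_poly of_int P)"
proof -
  have "\<exists>N P. N > 0 \<and> map_poly of_int P = smult (of_int N) p"
  proof (induction p)
    case 0
    show ?case by (rule exI[of _ 1], rule exI[of _ 0]) simp
  next
    case (pCons a p)
    then obtain N P where NP: "N > 0" "map_poly of_int P = smult (of_int N) p" by blast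
    obtain u v where "quotient_of a = (u, v)" by (cases "quotient_of a")
    then have a: "a = of_int u / of_int v" "v > 0"
      by (auto dest: quotient_of_div quotient_of_denom_pos)
    have "map_poly of_int (pCons (u * N) (smult v P)) = smult (of_int (N * v)) (pCons a p)"
      using NP(2) a by (simp add: map_poly_pCons map_poly_of_int_rat_hom mult.commute)
    then show ?case using NP(1) a(2) by (intro exI[of _ "N * v"] exI[of _ "pCons (u * N) (smult v P)"]) simp
  qed
  then obtain N P where NP: "N > 0" "map_poly of_int P = smult (of_int N) p" by blast
  have P0: "P \<noteq> 0" using NP assms by auto
  have "p = smult (1 / of_int N) (map_poly of_int P)" using NP by simp
  also have "P = smult (content P) (primitive_part P)" by simp
  finally have "p = smult (of_int (content P) / of_int N) (map_poly of_int (primitive_part P))"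
    by (simp add: map_poly_of_int_rat_hom del: content_times_primitive_part)
  then show ?thesis using that[of "primitive_part P"] P0 by simp
qed

text \<open>Gauss's lemma: with primitive integral multiples \<open>P\<close>, \<open>R\<close> of the two factors, \<open>P R\<close> is
  primitive too and proportional to \<open>q\<close>, hence equal to it up to sign; so \<open>P\<close> has leading
  coefficient \<open>\<plusminus>1\<close>.\<close>

lemma monic_rat_factor_of_monic_int_poly:
  fixes p r :: "rat poly" and q :: "int poly"
  assumes q: "lead_coeff q = 1" and p: "lead_coeff p = 1" and eq: "map_poly of_int q = p * r"
  shows "coeff p i \<in> \<int>"
proof -
  have q0: "q \<noteq> 0" using q by auto
  then have "map_poly (of_int :: int \<Rightarrow> rat) q \<noteq> 0" by (subst map_poly_eq_0_iff) auto
  then have "p \<noteq> 0" "r \<noteq> 0" using eq by auto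
  obtain c P where P: "content P = 1" "p = smult c (map_poly of_int P)"
    using rat_poly_eq_primitive_int_poly[OF \<open>p \<noteq> 0\<close>] .
  obtain d R where R: "content R = 1" "r = smult d (map_poly of_int R)"
    using rat_poly_eq_primitive_int_poly[OF \<open>r \<noteq> 0\<close>] .
  obtain u v where "quotient_of (c * d) = (u, v)" by (cases "quotient_of (c * d)")
  then have uv: "c * d = of_int u / of_int v" "v > 0"
    by (auto dest: quotient_of_div quotient_of_denom_pos)
  have "map_poly (of_int :: int \<Rightarrow> rat) (smult v q) = map_poly of_int (smult u (P * R))"
    using eq P(2) R(2) uv by (simp add: map_poly_of_int_rat_hom mult.commute)
  then have "(of_int :: int \<Rightarrow> rat) (coeff (smult v q) i) = of_int (coeff (smult u (P * R)) i)" for i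
    by (metis coeff_map_poly of_int_0)
  then have vq: "smult v q = smult u (P * R)" by (intro poly_eqI) (simp only: of_int_eq_iff)
  have "content q dvd 1" using content_dvd_coeff[of q "degree q"] q by simp
  then have "content q = 1" using normalize_content[of q] is_unit_normalize[of "content q"] by simp
  then have "\<bar>v\<bar> = \<bar>u\<bar>" using arg_cong[OF vq, of content] P(1) R(1)
    by (simp add: content_mult normalize_mult)
  moreover have "v = u * (lead_coeff P * lead_coeff R)"
    using arg_cong[OF vq, of lead_coeff] q
    by (simp only: lead_coeff_smult lead_coeff_mult mult_1_right)
  ultimately have "\<bar>u\<bar> * \<bar>lead_coeff P * lead_coeff R\<bar> = \<bar>u\<bar> * 1" "u \<noteq> 0"
    using uv(2) by (auto simp: abs_mult)
  then have "\<bar>lead_coeff P * lead_coeff R\<bar> = 1" by (simp only: mult_cancel_left) simp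
  then have "\<bar>lead_coeff P\<bar> = 1" by (rule abs_zmult_eq_1)
  moreover have "c * of_int (lead_coeff P) = 1"
  proof -
    have "degree (map_poly (of_int :: int \<Rightarrow> rat) P) = degree P" by (rule degree_map_poly) simp
    then have "lead_coeff (smult c (map_poly of_int P)) = c * of_int (lead_coeff P)"
      by (simp only: lead_coeff_smult) (simp add: coeff_map_poly)
    then show ?thesis using p unfolding P(2) by (rule trans[OF sym])
  qed
  ultimately have "c = 1 \<or> c = -1" by (auto simp: abs_if split: if_splits)
  then show ?thesis using P(2) by (auto simp: coeff_map_poly)
qed

lemma poly_of_rat_quadratic:
  assumes "degree p = 2"
  shows "poly (map_poly (of_rat :: rat \<Rightarrow> real) p) x
    = of_rat (coeff p 0) + of_rat (coeff p 1) * x + of_rat (coeff p 2) * x\<^sup>2"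
proof -
  have "map_poly (of_rat :: rat \<Rightarrow> real) p = [: of_rat (coeff p 0), of_rat (coeff p 1), of_rat (coeff p 2) :]"
    using assms
    by (intro poly_eqI) (auto simp: coeff_map_poly coeff_pCons coeff_eq_0 numeral_2_eq_2 split: nat.split)
  then show ?thesis by (simp add: algebra_simps power2_eq_square)
qed

text \<open>The conjugate of \<open>\<beta>\<close> is written \<open>a - \<beta>\<close>.\<close>

locale perron_quadratic =
  fixes \<beta> :: real and a b :: int
  assumes gt_1: "1 < \<beta>" and irrational: "\<beta> \<notin> \<rat>"
    and quadratic: "\<beta>\<^sup>2 = of_int a * \<beta> + of_int b"
    and conj_less: "\<bar>of_int a - \<beta>\<bar> < \<beta>"

lemma rat_poly_with_irrational_root:
  fixes x :: real
  assumes q: "poly (map_poly of_rat q) x = 0" "degree q \<le> 1" and x: "x \<notin> \<rat>"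
  shows "q = 0"
proof -
  have "map_poly (of_rat :: rat \<Rightarrow> real) q = [: of_rat (coeff q 0), of_rat (coeff q 1) :]"
    using q(2) by (intro poly_eqI) (auto simp: coeff_map_poly coeff_pCons coeff_eq_0 split: nat.split)
  then have lin: "of_rat (coeff q 0) + of_rat (coeff q 1) * x = 0" using q(1) by (simp add: mult.commute)
  have c1: "coeff q 1 = 0"
  proof (rule ccontr)
    assume "coeff q 1 \<noteq> 0"
    then have "x = of_rat (- coeff q 0 / coeff q 1)"
      using lin by (simp add: of_rat_divide of_rat_minus field_simps eq_neg_iff_add_eq_0)
    then show False using x by simp
  qed
  then have "coeff q 0 = 0" using lin by simp
  then show ?thesis using c1 q(2) by (intro poly_eqI) (metis coeff_0 coeff_eq_0 le_eq_less_or_eq less_one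
      not_le_imp_less order_le_less_trans)
qed

lemma irreducible_rat_poly_of_irrational_root:
  fixes x :: real
  assumes p: "degree p = 2" "poly (map_poly of_rat p) x = 0" and x: "x \<notin> \<rat>"
  shows "irreducible p"
proof -
  show ?thesis
  proof (rule irreducibleI)
    show "p \<noteq> 0" using p by auto
    then show "\<not> p dvd 1" using p by (metis is_unit_iff_degree zero_neq_numeral)
    fix q r assume qr: "p = q * r"
    then have nz: "q \<noteq> 0" "r \<noteq> 0" using \<open>p \<noteq> 0\<close> by auto
    then have deg: "degree q + degree r = 2" using p(1) qr by (simp add: degree_mult_eq)
    have "poly (map_poly of_rat q) x = 0 \<or> poly (map_poly of_rat r) x = 0"
      using p(2) unfolding qr map_poly_of_rat_hom by simp
    then have "degree q \<noteq> 1 \<or> degree r \<noteq> 1"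
      using rat_poly_with_irrational_root[OF _ _ x] nz by (metis order_refl)
    then have "degree q = 0 \<or> degree r = 0" using deg by linarith
    then show "q dvd 1 \<or> r dvd 1" using nz is_unit_iff_degree by blast
  qed
qed

lemma (in perron_quadratic) is_quadratic_Perron: "quadratic_Perron \<beta>"
proof -
  define p :: "rat poly" where "p = [: - of_int b, - of_int a, 1 :]"
  have root: "poly (map_poly of_rat p) x = x\<^sup>2 - of_int a * x - of_int b" for x :: real
    by (subst poly_of_rat_quadratic) (simp_all add: p_def numeral_2_eq_2 of_rat_minus)
  have zero: "poly (map_poly of_rat p) \<beta> = 0" using quadratic by (simp add: root)
  have deg: "degree p = 2" by (simp add: p_def)
  have min: "is_min_poly p \<beta>"
    unfolding is_min_poly_def
    using irreducible_rat_poly_of_irrational_root[OF deg zero irrational] zero by (simp add: p_def)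
  have "algebraic_int \<beta>"
  proof (rule algebraic_int.intros[of "[: - of_int b, - of_int a, 1 :]"])
    show "\<forall>i. coeff [: - of_int b, - of_int a, 1 :: real :] i \<in> \<int>"
      by (auto simp: coeff_pCons split: nat.split)
    show "poly [: - of_int b, - of_int a, 1 :] \<beta> = 0"
      using quadratic by (simp add: algebra_simps power2_eq_square)
  qed simp
  moreover have "poly (map_poly of_rat p) (of_int a - \<beta>) = 0"
    using quadratic by (simp add: root algebra_simps power2_eq_square)
  moreover have "of_int a - \<beta> \<noteq> \<beta>"
  proof
    assume "of_int a - \<beta> = \<beta>"
    then have "\<beta> = of_int a / 2" by simp
    then show False using irrational by (metis Rats_divide Rats_of_int Rats_number_of)
  qed
  ultimately show ?thesis
    unfolding quadratic_Perron_def using gt_1 min deg conj_less by blast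
qed

lemma quadratic_Perron_imp_perron_quadratic:
  assumes "quadratic_Perron \<beta>"
  obtains a b where "perron_quadratic \<beta> a b"
proof -
  obtain p \<beta>' where gt1: "\<beta> > 1" and ai: "algebraic_int \<beta>" and p: "is_min_poly p \<beta>" "degree p = 2"
    and \<beta>': "poly (map_poly of_rat p) \<beta>' = 0" "\<beta>' \<noteq> \<beta>" "\<bar>\<beta>'\<bar> < \<beta>"
    using assms unfolding quadratic_Perron_def by blast
  have mon: "lead_coeff p = 1" and irr: "irreducible p" and root: "poly (map_poly of_rat p) \<beta> = 0"
    using p(1) by (auto simp: is_min_poly_def)
  obtain q :: "int poly" where q: "poly (map_poly of_int q) \<beta> = 0" "lead_coeff q = 1"
    using ai unfolding algebraic_int_altdef_ipoly by blast
  have q': "map_poly of_rat (map_poly of_int q) = (map_poly of_int q :: real poly)"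
    by (simp add: map_poly_map_poly o_def)
  have irrational: "\<beta> \<notin> \<rat>"
  proof
    assume "\<beta> \<in> \<rat>"
    then obtain t where t: "\<beta> = of_rat t" by (rule Rats_cases)
    have "poly p t = 0" using root t by (simp add: poly_map_poly_of_rat)
    then have "[:-t, 1:] dvd p" by (simp add: poly_eq_0_iff_dvd)
    then obtain s where s: "p = [:-t, 1:] * s" by blast
    then have "[:-t, 1:] dvd 1 \<or> s dvd 1" using irr irreducibleD by blast
    moreover have "\<not> [:-t, 1:] dvd 1" by (simp add: is_unit_iff_degree)
    moreover have "\<not> s dvd 1"
    proof -
      have "s \<noteq> 0" using s irr by auto
      then have "degree p = 1 + degree s" unfolding s by (subst degree_mult_eq) auto
      then show ?thesis using p(2) \<open>s \<noteq> 0\<close> by (simp add: is_unit_iff_degree)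
    qed
    ultimately show False by blast
  qed
  have "p dvd map_poly of_int q"
  proof -
    define r where "r = map_poly of_int q mod p"
    have "map_poly of_int q = map_poly of_int q div p * p + r" by (simp add: r_def)
    then have "map_poly of_rat (map_poly of_int q) =
        map_poly of_rat (map_poly of_int q div p) * map_poly of_rat p + map_poly (of_rat :: rat \<Rightarrow> real) r"
      by (simp only: map_poly_of_rat_hom flip: map_poly_of_rat_hom)
    then have "poly (map_poly of_rat r) \<beta> = 0" using q(1) root by (simp add: q')
    moreover have "degree r \<le> 1" using degree_mod_less'[of p "map_poly of_int q"] p(2)
      by (cases "p = 0"; cases "r = 0") (auto simp: r_def)
    ultimately have "r = 0" using irrational by (intro rat_poly_with_irrational_root)
    then show ?thesis by (simp add: r_def dvd_eq_mod_eq_0)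
  qed
  then obtain r where r: "map_poly of_int q = p * r" by blast
  have ints: "coeff p i \<in> \<int>" for i
    by (rule monic_rat_factor_of_monic_int_poly[OF q(2) mon r])
  obtain a b where ab: "- coeff p 1 = of_int a" "- coeff p 0 = of_int b"
    using ints by (metis Ints_cases Ints_minus)
  have c: "of_rat (coeff p 1) = - (of_int a :: real)" "of_rat (coeff p 0) = - (of_int b :: real)"
    using ab by (metis minus_minus of_rat_minus of_rat_of_int_eq)+
  have ev: "poly (map_poly of_rat p) x = x\<^sup>2 - of_int a * x - of_int b" for x :: real
    using mon p(2) c by (simp add: poly_of_rat_quadratic)
  have eq: "\<beta>\<^sup>2 = of_int a * \<beta> + of_int b" "\<beta>'\<^sup>2 = of_int a * \<beta>' + of_int b"
    using root \<beta>'(1) by (simp_all add: ev)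
  then have "(\<beta>' - \<beta>) * (\<beta>' + \<beta> - of_int a) = 0"
    by (simp add: algebra_simps power2_eq_square)
  then have conj: "of_int a - \<beta> = \<beta>'" using \<beta>'(2) by simp
  have "perron_quadratic \<beta> a b"
    by unfold_locales (use gt1 irrational eq conj \<beta>'(3) in auto)
  then show ?thesis using that by blast
qed

section \<open>The field generated by a quadratic number\<close>

lemma generator_in_rat_adjoin: "\<beta> \<in> rat_adjoin \<beta>"
  unfolding rat_adjoin_def by (rule hull_inc) simp

lemma real_subfieldD:
  assumes "real_subfield K"
  shows "0 \<in> K" "1 \<in> K" "x \<in> K \<Longrightarrow> y \<in> K \<Longrightarrow> x + y \<in> K" "x \<in> K \<Longrightarrow> y \<in> K \<Longrightarrow> x * y \<in> K"
    "x \<in> K \<Longrightarrow> - x \<in> K" "x \<in> K \<Longrightarrow> inverse x \<in> K" "x \<in> K \<Longrightarrow> y \<in> K \<Longrightarrow> x - y \<in> K"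
    "x \<in> K \<Longrightarrow> y \<in> K \<Longrightarrow> x / y \<in> K"
proof -
  show K: "0 \<in> K" "1 \<in> K" "x \<in> K \<Longrightarrow> y \<in> K \<Longrightarrow> x + y \<in> K" "x \<in> K \<Longrightarrow> y \<in> K \<Longrightarrow> x * y \<in> K"
    "x \<in> K \<Longrightarrow> - x \<in> K" "x \<in> K \<Longrightarrow> inverse x \<in> K" for x y
    using assms by (simp_all add: real_subfield_def)
  show "x \<in> K \<Longrightarrow> y \<in> K \<Longrightarrow> x - y \<in> K" using K(3)[OF _ K(5), of x y] by simp
  show "x \<in> K \<Longrightarrow> y \<in> K \<Longrightarrow> x / y \<in> K" using K(4)[OF _ K(6), of x y] by (simp add: divide_inverse)
qed

lemma real_subfield_rat_adjoin: "real_subfield (rat_adjoin \<beta>)"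
  unfolding rat_adjoin_def
proof (rule hull_in)
  fix T assume "Ball T real_subfield"
  then have K: "real_subfield K" if "K \<in> T" for K using that by blast
  have "0 \<in> \<Inter> T" "1 \<in> \<Inter> T" using K by (simp_all add: real_subfieldD(1,2))
  moreover have "x + y \<in> \<Inter> T" "x * y \<in> \<Inter> T" if "x \<in> \<Inter> T" "y \<in> \<Inter> T" for x y
    using that by (simp_all add: real_subfieldD(3,4) K)
  moreover have "- x \<in> \<Inter> T" "inverse x \<in> \<Inter> T" if "x \<in> \<Inter> T" for x
    using that by (simp_all add: real_subfieldD(5,6) K)
  ultimately show "real_subfield (\<Inter> T)" unfolding real_subfield_def by (intro conjI ballI)
qed

lemma of_int_in_real_subfield:
  assumes "real_subfield K" shows "of_int n \<in> K"
proof -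
  note K = real_subfieldD[OF assms]
  have nat: "of_nat m \<in> K" for m by (induction m) (auto intro: K)
  show ?thesis
  proof (cases "0 \<le> n")
    case True
    then show ?thesis using nat[of "nat n"] by simp
  next
    case False
    then have "real_of_int n = - of_nat (nat (- n))" by simp
    then show ?thesis using K(5)[OF nat, of "nat (- n)"] by (simp only:)
  qed
qed

lemma of_rat_in_real_subfield:
  assumes "real_subfield K" shows "of_rat r \<in> K"
proof (cases r)
  case (Fract n d)
  then have "of_rat r = (of_int n / of_int d :: real)" using Fract by (simp add: of_rat_rat)
  then show ?thesis
    using real_subfieldD(8)[OF assms of_int_in_real_subfield[OF assms] of_int_in_real_subfield[OF assms], of n d]
    by (simp only:)
qed

lemma regular_cf_quotient_in_subfield:
  assumes "real_subfield K" "x \<in> K"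
  shows "regular_cf_quotient x n \<in> K"
proof (induction n)
  case (Suc n)
  show ?case unfolding regular_cf_quotient.simps
    by (intro real_subfieldD(2,7,8)[OF assms(1)] of_int_in_real_subfield[OF assms(1)] Suc.IH)
qed (simp add: assms)

context perron_quadratic
begin

lemma conj_eq: "(of_int a - \<beta>)\<^sup>2 = of_int a * (of_int a - \<beta>) + of_int b"
proof -
  have "(of_int a - \<beta>)\<^sup>2 = of_int a * (of_int a - \<beta>) + (\<beta>\<^sup>2 - of_int a * \<beta>)"
    by (simp add: algebra_simps power2_eq_square)
  then show ?thesis by (simp add: quadratic)
qed

lemma rat_combination_unique:
  assumes "of_rat r + of_rat s * \<beta> = 0" shows "r = 0 \<and> s = 0"
proof -
  have "s = 0"
  proof (rule ccontr)
    assume s: "s \<noteq> 0"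
    then have "\<beta> = of_rat (- r / s)"
      using assms by (simp add: of_rat_divide of_rat_minus field_simps eq_neg_iff_add_eq_0)
    then show False using irrational by simp
  qed
  then show ?thesis using assms by simp
qed

text \<open>The norm form of \<open>r + s \<beta>\<close> is its product with the conjugate; rationalising the
  denominator with it makes the rational combinations a field.\<close>

lemma rat_adjoin_eq: "rat_adjoin \<beta> = {of_rat r + of_rat s * \<beta> | r s. True}" (is "_ = ?L")
proof
  have I: "of_rat r + of_rat s * \<beta> \<in> ?L" for r s by blast
  have inv: "inverse x \<in> ?L" if "x \<in> ?L" for x
  proof -
    obtain r s where x: "x = of_rat r + of_rat s * \<beta>" using \<open>x \<in> ?L\<close> by blast
    define N where "N = r * r + r * s * of_int a - s * s * of_int b"
    define c where "c = of_rat (r + s * of_int a) + of_rat (- s) * \<beta>"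
    have "x * c = of_rat r * of_rat r + of_rat r * of_rat s * of_int a
        - of_rat s * of_rat s * (\<beta>\<^sup>2 - of_int a * \<beta>)"
      unfolding x c_def by (simp add: of_rat_add of_rat_mult of_rat_minus algebra_simps power2_eq_square)
    then have N: "x * c = of_rat N"
      unfolding quadratic N_def by (simp add: of_rat_add of_rat_mult of_rat_diff)
    show ?thesis
    proof (cases "x = 0")
      case True
      then show ?thesis using I[of 0 0] by simp
    next
      case False
      have "c \<noteq> 0"
      proof
        assume "c = 0"
        then have "r + s * of_int a = 0 \<and> - s = 0"
          unfolding c_def by (rule rat_combination_unique)
        then show False using False x by auto
      qed
      then have "of_rat N \<noteq> (0 :: real)" using N False by (metis mult_eq_0_iff)
      then have "N \<noteq> 0" by auto
      have "inverse x = c / of_rat N"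
        using N False \<open>c \<noteq> 0\<close> by (metis inverse_eq_divide nonzero_divide_mult_cancel_right)
      also have "\<dots> = of_rat ((r + s * of_int a) / N) + of_rat (- s / N) * \<beta>"

      proof -
        have "(of_rat u + of_rat v * \<beta>) / of_rat N = of_rat (u / N) + of_rat (v / N) * \<beta>" for u v
          by (simp add: of_rat_divide add_divide_distrib)
        then show ?thesis unfolding c_def .
      qed
      finally show ?thesis using I by metis
    qed
  qed
  have add: "x + y \<in> ?L" if xy: "x \<in> ?L" "y \<in> ?L" for x y
  proof -
    obtain r s r' s' where "x = of_rat r + of_rat s * \<beta>" "y = of_rat r' + of_rat s' * \<beta>"
      using xy by blast
    then have "x + y = of_rat (r + r') + of_rat (s + s') * \<beta>" by (simp add: of_rat_add algebra_simps)
    then show ?thesis using I by metis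
  qed
  have mult: "x * y \<in> ?L" if xy: "x \<in> ?L" "y \<in> ?L" for x y
  proof -
    obtain r s r' s' where "x = of_rat r + of_rat s * \<beta>" "y = of_rat r' + of_rat s' * \<beta>"
      using xy by blast
    then have "x * y = of_rat r * of_rat r' + (of_rat r * of_rat s' + of_rat s * of_rat r') * \<beta>
        + of_rat s * of_rat s' * \<beta>\<^sup>2"
      by (simp add: algebra_simps power2_eq_square)
    also have "\<dots> = of_rat (r * r' + s * s' * of_int b) + of_rat (r * s' + s * r' + s * s' * of_int a) * \<beta>"
      unfolding quadratic by (simp add: of_rat_add of_rat_mult algebra_simps)
    finally show ?thesis using I by metis
  qed
  have minus: "- x \<in> ?L" if x: "x \<in> ?L" for x
    using mult[OF x I[of "-1" 0]] by (simp add: of_rat_minus)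
  have "0 \<in> ?L" "1 \<in> ?L" using I[of 0 0] I[of 1 0] by simp_all
  then have "real_subfield ?L"
    unfolding real_subfield_def using add mult minus inv by (intro conjI ballI)
  moreover have "{\<beta>} \<subseteq> ?L" using I[of 0 1] by simp
  ultimately show "rat_adjoin \<beta> \<subseteq> ?L" unfolding rat_adjoin_def by (intro hull_minimal)
  show "?L \<subseteq> rat_adjoin \<beta>"
    by (auto intro!: real_subfieldD(3,4)[OF real_subfield_rat_adjoin]
        of_rat_in_real_subfield[OF real_subfield_rat_adjoin] generator_in_rat_adjoin)
qed

lemma real_quadratic_field_rat_adjoin: "real_quadratic_field (rat_adjoin \<beta>)"
proof -
  have span: "x \<in> rat_real.span {1, \<beta>} \<longleftrightarrow> (\<exists>r s. x = of_rat r + of_rat s * \<beta>)" for x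
    by (simp add: rat_real.span_breakdown_eq diff_eq_eq add.commute)
  have "rat_adjoin \<beta> = rat_real.span {1, \<beta>}" unfolding rat_adjoin_eq using span by auto
  moreover have "rat_real.independent {1, \<beta>}"
  proof -
    have "1 \<noteq> \<beta>" using gt_1 by simp
    moreover have "1 \<notin> rat_real.span {\<beta>}"
    proof
      assume "1 \<in> rat_real.span {\<beta>}"
      then obtain s where "1 = of_rat s * \<beta>" by (auto simp: rat_real.span_singleton)
      then have "of_rat (-1) + of_rat s * \<beta> = 0" by (simp add: of_rat_minus)
      from rat_combination_unique[OF this] show False by simp
    qed
    moreover have "rat_real.independent {\<beta>}"
      using gt_1 by (intro rat_real.independent_insertI rat_real.independent_empty) auto
    ultimately show ?thesis by (simp add: rat_real.independent_insertI)
  qed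
  moreover have "card {1, \<beta>} = 2" using gt_1 by simp
  ultimately have "rat_real.dim (rat_adjoin \<beta>) = 2"
    by (metis rat_real.dim_eq_card_independent rat_real.dim_span)
  then show ?thesis using real_subfield_rat_adjoin by (simp add: real_quadratic_field_def)
qed

section \<open>Integers of the field and their conjugates\<close>

text \<open>Pairs \<open>(x, x')\<close> of an element of \<open>\<int>[\<beta>]\<close> and its conjugate. As a relation it needs no
  coordinate functions on the field.\<close>

definition conjugates :: "real \<Rightarrow> real \<Rightarrow> bool" where
  "conjugates x x' \<longleftrightarrow> (\<exists>m n::int. x = of_int m + of_int n * \<beta> \<and> x' = of_int m + of_int n * (of_int a - \<beta>))"

lemma conjugates_of_int: "conjugates (of_int m) (of_int m)"
  unfolding conjugates_def by (rule exI[of _ m], rule exI[of _ 0]) simp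

lemma conjugates_generator: "conjugates \<beta> (of_int a - \<beta>)"
  unfolding conjugates_def by (rule exI[of _ 0], rule exI[of _ 1]) simp

lemma conjugates_add:
  assumes "conjugates x x'" "conjugates y y'" shows "conjugates (x + y) (x' + y')"
proof -
  obtain m n k l where "x = of_int m + of_int n * \<beta>" "x' = of_int m + of_int n * (of_int a - \<beta>)"
    "y = of_int k + of_int l * \<beta>" "y' = of_int k + of_int l * (of_int a - \<beta>)"
    using assms unfolding conjugates_def by blast
  then show ?thesis unfolding conjugates_def
    by (intro exI[of _ "m + k"] exI[of _ "n + l"]) (simp add: algebra_simps)
qed

lemma conjugates_mult:
  assumes "conjugates x x'" "conjugates y y'" shows "conjugates (x * y) (x' * y')"
proof -
  obtain m n k l where xy: "x = of_int m + of_int n * \<beta>" "x' = of_int m + of_int n * (of_int a - \<beta>)"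
    "y = of_int k + of_int l * \<beta>" "y' = of_int k + of_int l * (of_int a - \<beta>)"
    using assms unfolding conjugates_def by blast
  have *: "(of_int m + of_int n * t) * (of_int k + of_int l * t) =
      of_int (m * k + n * l * b) + of_int (m * l + n * k + n * l * a) * t"
    if "t\<^sup>2 = of_int a * t + of_int b" for t :: real
  proof -
    have "(of_int m + of_int n * t) * (of_int k + of_int l * t) =
        of_int m * of_int k + (of_int m * of_int l + of_int n * of_int k) * t + of_int n * of_int l * t\<^sup>2"
      by (simp add: algebra_simps power2_eq_square)
    then show ?thesis unfolding that by (simp add: algebra_simps)
  qed
  show ?thesis unfolding conjugates_def xy *[OF quadratic] *[OF conj_eq] by blast
qed

lemma conjugates_uminus:
  assumes "conjugates x x'" shows "conjugates (- x) (- x')"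
  using conjugates_mult[OF assms conjugates_of_int[of "-1"]] by simp

lemma conjugates_in_rat_adjoin:
  assumes "conjugates x x'" shows "x \<in> rat_adjoin \<beta>"
  using assms unfolding conjugates_def
  by (auto intro!: real_subfieldD(3,4)[OF real_subfield_rat_adjoin]
      of_int_in_real_subfield[OF real_subfield_rat_adjoin] generator_in_rat_adjoin)

text \<open>The product is the norm, a nonzero rational integer.\<close>

lemma one_le_norm:
  assumes "conjugates x x'" "x \<noteq> 0" shows "1 \<le> \<bar>x * x'\<bar>"
proof -
  obtain m n where x: "x = of_int m + of_int n * \<beta>" "x' = of_int m + of_int n * (of_int a - \<beta>)"
    using assms(1) unfolding conjugates_def by blast
  define N where "N = m * m + m * n * a - n * n * b"
  have "x * x' = of_int m * of_int m + of_int m * of_int n * of_int a + of_int n * of_int n * (of_int a * \<beta> - \<beta>\<^sup>2)"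
    unfolding x by (simp add: algebra_simps power2_eq_square)
  also have "\<dots> = of_int N" unfolding quadratic by (simp add: N_def algebra_simps)
  finally have N: "x * x' = of_int N" .
  have "x' \<noteq> 0"
  proof
    assume "x' = 0"
    then have "of_rat (of_int (m + n * a)) + of_rat (of_int (- n)) * \<beta> = 0"
      unfolding x by (simp add: of_rat_add of_rat_mult of_rat_minus algebra_simps)
    note 0 = rat_combination_unique[OF this]
    then have "n = 0" by simp
    moreover have "m = 0" using conjunct1[OF 0] unfolding \<open>n = 0\<close> by simp
    ultimately show False using x assms(2) by simp
  qed
  then have "N \<noteq> 0" using N assms(2) by auto
  then have "1 \<le> \<bar>N\<bar>" by linarith
  then show ?thesis unfolding N by linarith
qed

text \<open>A bound on an element and on its conjugate bounds both coordinates. Since \<open>\<beta>\<close>-integers satisfy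
  \<open>\<bar>x'\<bar> \<le> \<bar>x\<bar>\<close>, this makes them locally finite.\<close>

lemma finite_bounded_conjugates: "finite {x. \<bar>x\<bar> \<le> M \<and> (\<exists>x'. conjugates x x' \<and> \<bar>x'\<bar> \<le> \<bar>x\<bar>)}"
proof -
  define d where "d = \<beta> - (of_int a - \<beta>)"
  have d: "d > 0" using conj_less by (simp add: d_def)
  define B where "B = \<lceil>2 * M / d\<rceil>"
  define C where "C = \<lceil>M + of_int B * \<beta>\<rceil>"
  have "{x. \<bar>x\<bar> \<le> M \<and> (\<exists>x'. conjugates x x' \<and> \<bar>x'\<bar> \<le> \<bar>x\<bar>)}
      \<subseteq> (\<lambda>(m, n). of_int m + of_int n * \<beta>) ` ({-C..C} \<times> {-B..B})"
  proof
    fix x assume "x \<in> {x. \<bar>x\<bar> \<le> M \<and> (\<exists>x'. conjugates x x' \<and> \<bar>x'\<bar> \<le> \<bar>x\<bar>)}"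
    then obtain m n where le: "\<bar>x\<bar> \<le> M" "\<bar>of_int m + of_int n * (of_int a - \<beta>)\<bar> \<le> \<bar>x\<bar>"
      and x: "x = of_int m + of_int n * \<beta>"
      unfolding conjugates_def by blast
    have "of_int n * d = x - (of_int m + of_int n * (of_int a - \<beta>))"
      by (simp add: x d_def algebra_simps)
    then have "\<bar>of_int n * d\<bar> \<le> 2 * M" using le by linarith
    then have "\<bar>of_int n\<bar> * d \<le> 2 * M" using d by (simp add: abs_mult)
    then have "\<bar>of_int n :: real\<bar> \<le> 2 * M / d" using d by (simp add: pos_le_divide_eq)
    also have "\<dots> \<le> of_int B" by (simp add: B_def)
    finally have n: "\<bar>of_int n :: real\<bar> \<le> of_int B" .
    have "\<bar>of_int n * \<beta>\<bar> = \<bar>of_int n\<bar> * \<beta>" using gt_1 by (simp add: abs_mult)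
    then have "\<bar>of_int m :: real\<bar> \<le> \<bar>x\<bar> + \<bar>of_int n\<bar> * \<beta>" using x by linarith
    also have "\<dots> \<le> M + of_int B * \<beta>" using le n gt_1 by (intro add_mono mult_right_mono) auto
    also have "\<dots> \<le> of_int C" by (simp add: C_def)
    finally have m: "\<bar>of_int m :: real\<bar> \<le> of_int C" .
    have "m \<in> {-C..C}" "n \<in> {-B..B}" using m n by auto
    then show "x \<in> (\<lambda>(m, n). of_int m + of_int n * \<beta>) ` ({-C..C} \<times> {-B..B})"
      unfolding x by (intro image_eqI[of _ _ "(m, n)"]) auto
  qed
  then show ?thesis by (rule finite_subset) auto
qed

end

section \<open>Beta-integers\<close>

lemma has_sum_integer_digits:
  fixes d :: "int \<Rightarrow> int" and \<beta> :: real
  assumes d: "\<forall>i<0. d i = 0" and jm: "j + 1 = int m"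
  shows "((\<lambda>i. of_int (d i) * \<beta> powi i) has_sum (\<Sum>i<m. of_int (d (int i)) * \<beta> ^ i)) {..j}"
proof -
  have "((\<lambda>i. of_int (d i) * \<beta> powi i) has_sum (\<Sum>i\<in>int ` {..<m}. of_int (d i) * \<beta> powi i)) (int ` {..<m})"
    by (rule has_sum_finite) simp
  also have "(\<Sum>i\<in>int ` {..<m}. of_int (d i) * \<beta> powi i) = (\<Sum>i<m. of_int (d (int i)) * \<beta> ^ i)"
    by (subst sum.reindex) auto
  also have "((\<lambda>i. of_int (d i) * \<beta> powi i) has_sum (\<Sum>i<m. of_int (d (int i)) * \<beta> ^ i)) (int ` {..<m})
      \<longleftrightarrow> ((\<lambda>i. of_int (d i) * \<beta> powi i) has_sum (\<Sum>i<m. of_int (d (int i)) * \<beta> ^ i)) {..j}"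
  proof (rule has_sum_cong_neutral)
    fix i assume i: "i \<in> {..j} - int ` {..<m}"
    have "i < 0"
    proof (rule ccontr)
      assume "\<not> i < 0"
      then have "i = int (nat i)" "nat i < m" using i jm by auto
      then show False using i by blast
    qed
    then show "of_int (d i) * \<beta> powi i = 0" using d by simp
  next
    fix i assume "i \<in> int ` {..<m} - {..j}"
    then show "of_int (d i) * \<beta> powi i = 0" using jm by auto
  qed auto
  finally show ?thesis .
qed

lemma beta_integer_digits:
  assumes "x \<in> beta_integers \<beta>"
  obtains n and e :: "nat \<Rightarrow> int"
  where "\<And>i. 0 \<le> e i \<and> of_int (e i) < \<beta>" "\<bar>x\<bar> = (\<Sum>i<n. of_int (e i) * \<beta> ^ i)"
proof -
  from assms obtain d where g: "greedy_expansion \<beta> \<bar>x\<bar> d" and d0: "\<forall>i<0. d i = 0"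
    unfolding beta_integers_def by blast
  have d: "\<forall>i. 0 \<le> d i \<and> of_int (d i) < \<beta>"
    using g unfolding greedy_expansion_def by (rule conjunct1)
  from g obtain k where hs: "((\<lambda>i. real_of_int (d i) * \<beta> powi i) has_sum \<bar>x\<bar>) {..k}"
    unfolding greedy_expansion_def by (elim conjE exE)
  have "\<bar>x\<bar> = (\<Sum>i<nat (k + 1). of_int (d (int i)) * \<beta> ^ i)"
  proof (cases "k + 1 < 0")
    case True
    have "((\<lambda>i. real_of_int (d i) * \<beta> powi i) has_sum 0) {..k}"
      by (rule has_sum_0) (use d0 True in auto)
    then show ?thesis using has_sum_unique[OF hs] True by simp
  next
    case False
    then show ?thesis using has_sum_unique[OF hs has_sum_integer_digits[OF d0, of k "nat (k + 1)"]] by simp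
  qed
  then show ?thesis using that[of "\<lambda>i. d (int i)" "nat (k + 1)"] d by blast
qed

text \<open>The greedy condition at the fractional positions is void, since the digits there vanish.\<close>

lemma beta_integerI:
  fixes e :: "nat \<Rightarrow> int"
  assumes \<beta>: "\<beta> > 1" and digits: "\<And>i. i < n \<Longrightarrow> 0 \<le> e i \<and> of_int (e i) < \<beta>"
    and greedy: "\<And>m. m \<le> n \<Longrightarrow> (\<Sum>i<m. of_int (e i) * \<beta> ^ i) < \<beta> ^ m"
    and x: "\<bar>x\<bar> = (\<Sum>i<n. of_int (e i) * \<beta> ^ i)"
  shows "x \<in> beta_integers \<beta>"
proof -
  define d where "d i = (if 0 \<le> i \<and> i < int n then e (nat i) else 0)" for i
  define k where "k = int n - 1"
  have d0: "\<forall>i<0. d i = 0" by (simp add: d_def)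
  have same: "(\<Sum>i<m. of_int (d (int i)) * \<beta> ^ i) = (\<Sum>i<m. of_int (e i) * \<beta> ^ i)" if "m \<le> n" for m
    by (rule sum.cong) (use that in \<open>auto simp: d_def\<close>)
  have "0 \<le> d i \<and> of_int (d i) < \<beta>" for i
    using digits[of "nat i"] \<beta> by (auto simp: d_def)
  moreover have "\<forall>i>k. d i = 0" by (simp add: d_def k_def)
  moreover have "((\<lambda>i. real_of_int (d i) * \<beta> powi i) has_sum \<bar>x\<bar>) {..k}"
    using has_sum_integer_digits[OF d0, of k n \<beta>] unfolding same[OF order_refl] x by (simp add: k_def)
  moreover have "(\<Sum>\<^sub>\<infinity>i\<in>{..j}. real_of_int (d i) * \<beta> powi i) < \<beta> powi (j + 1)" if j: "j \<le> k" for j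
  proof (cases "j < 0")
    case True
    have "(\<Sum>\<^sub>\<infinity>i\<in>{..j}. real_of_int (d i) * \<beta> powi i) = 0"
      by (rule infsum_0) (use True d0 in auto)
    then show ?thesis using \<beta> by simp
  next
    case False
    define m where "m = nat (j + 1)"
    have jm: "j + 1 = int m" "m \<le> n" using False j by (auto simp: m_def k_def)
    have "(\<Sum>\<^sub>\<infinity>i\<in>{..j}. real_of_int (d i) * \<beta> powi i) = (\<Sum>i<m. of_int (d (int i)) * \<beta> ^ i)"
      by (rule infsumI[OF has_sum_integer_digits[OF d0 jm(1)]])
    also have "\<dots> < \<beta> ^ m" using same[OF jm(2)] greedy[OF jm(2)] by simp
    also have "\<dots> = \<beta> powi (j + 1)" unfolding jm(1) by simp
    finally show ?thesis .
  qed
  ultimately have "greedy_expansion \<beta> \<bar>x\<bar> d" unfolding greedy_expansion_def by blast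
  then show ?thesis unfolding beta_integers_def using d0 by blast
qed

lemma uminus_in_beta_integers: "- x \<in> beta_integers \<beta> \<longleftrightarrow> x \<in> beta_integers \<beta>"
  by (simp add: beta_integers_def)

lemma of_int_in_beta_integers:
  assumes "\<beta> > 1" "\<bar>of_int m\<bar> < \<beta>" shows "of_int m \<in> beta_integers \<beta>"
proof (rule beta_integerI[where n = 1 and e = "\<lambda>_. \<bar>m\<bar>"])
  fix k :: nat assume "k \<le> 1"
  then consider "k = 0" | "k = 1" by linarith
  then show "(\<Sum>i<k. of_int \<bar>m\<bar> * \<beta> ^ i) < \<beta> ^ k" using assms by cases auto
qed (use assms in auto)

lemma base_in_beta_integers:
  assumes "\<beta> > 1" shows "\<beta> \<in> beta_integers \<beta>"
proof (rule beta_integerI[where n = 2 and e = "\<lambda>i. if i = 1 then 1 else 0"])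
  fix k :: nat assume "k \<le> 2"
  then have k: "k = 0 \<or> k = 1 \<or> k = 2" by linarith
  have "\<beta> * 1 < \<beta> * \<beta>" using assms by (intro mult_strict_left_mono) auto
  then show "(\<Sum>i<k. of_int (if i = 1 then 1 else 0) * \<beta> ^ i) < \<beta> ^ k"
    using k assms by (elim disjE) (simp_all add: numeral_2_eq_2)
qed (use assms in \<open>auto simp: numeral_2_eq_2\<close>)

text \<open>The greedy algorithm, stopped at the units digit.\<close>

lemma beta_integer_below:
  assumes \<beta>: "\<beta> > 1" and x: "0 \<le> x"
  obtains y where "y \<in> beta_integers \<beta>" "0 \<le> y" "y \<le> x" "x < y + 1"
proof -
  have "\<exists>e::nat \<Rightarrow> int. (\<forall>i. 0 \<le> e i \<and> of_int (e i) < \<beta>) \<and>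
      (\<forall>m\<le>n. (\<Sum>i<m. of_int (e i) * \<beta> ^ i) < \<beta> ^ m) \<and>
      (\<Sum>i<n. of_int (e i) * \<beta> ^ i) \<le> x \<and> x < (\<Sum>i<n. of_int (e i) * \<beta> ^ i) + 1"
    if "0 \<le> x" "x < \<beta> ^ n" for n x
    using that
  proof (induction n arbitrary: x)
    case 0
    then show ?case using \<beta> by (intro exI[of _ "\<lambda>_. 0"]) auto
  next
    case (Suc n)
    have pos: "\<beta> ^ n > 0" using \<beta> by simp
    define c where "c = \<lfloor>x / \<beta> ^ n\<rfloor>"
    have c: "0 \<le> c" "of_int c \<le> x / \<beta> ^ n" "x / \<beta> ^ n < of_int c + 1"
      using Suc.prems pos unfolding c_def by (simp, linarith+)
    define r where "r = x - of_int c * \<beta> ^ n"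
    have r: "0 \<le> r" "r < \<beta> ^ n" using c pos by (auto simp: r_def field_simps)
    have "x / \<beta> ^ n < \<beta>" using Suc.prems pos by (simp add: field_simps)
    then have c\<beta>: "of_int c < \<beta>" using c by linarith
    obtain e :: "nat \<Rightarrow> int" where e: "\<forall>i. 0 \<le> e i \<and> of_int (e i) < \<beta>"
      "\<forall>m\<le>n. (\<Sum>i<m. of_int (e i) * \<beta> ^ i) < \<beta> ^ m"
      "(\<Sum>i<n. of_int (e i) * \<beta> ^ i) \<le> r" "r < (\<Sum>i<n. of_int (e i) * \<beta> ^ i) + 1"
      using Suc.IH[OF r] by blast
    define f where "f = e(n := c)"
    have same: "(\<Sum>i<m. of_int (f i) * \<beta> ^ i) = (\<Sum>i<m. of_int (e i) * \<beta> ^ i)" if "m \<le> n" for m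
      by (rule sum.cong) (use that in \<open>auto simp: f_def\<close>)
    have top: "(\<Sum>i<Suc n. of_int (f i) * \<beta> ^ i) = (\<Sum>i<n. of_int (e i) * \<beta> ^ i) + of_int c * \<beta> ^ n"
      using same[of n] by (simp add: f_def)
    have le: "(\<Sum>i<Suc n. of_int (f i) * \<beta> ^ i) \<le> x" "x < (\<Sum>i<Suc n. of_int (f i) * \<beta> ^ i) + 1"
      unfolding top using e(3,4) by (auto simp: r_def)
    have "(\<Sum>i<m. of_int (f i) * \<beta> ^ i) < \<beta> ^ m" if "m \<le> Suc n" for m
    proof (cases "m = Suc n")
      case True
      then show ?thesis using le(1) Suc.prems by auto
    next
      case False
      then show ?thesis using same e(2) that by auto
    qed
    moreover have "\<forall>i. 0 \<le> f i \<and> of_int (f i) < \<beta>" using e(1) c(1) c\<beta> by (simp add: f_def)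
    ultimately show ?case using le by blast
  qed note greedy = this
  obtain n where "x < \<beta> ^ n" using real_arch_pow[OF \<beta>] by blast
  from greedy[OF x this] obtain e :: "nat \<Rightarrow> int" where e: "\<forall>i. 0 \<le> e i \<and> of_int (e i) < \<beta>"
      "\<forall>m\<le>n. (\<Sum>i<m. of_int (e i) * \<beta> ^ i) < \<beta> ^ m"
      "(\<Sum>i<n. of_int (e i) * \<beta> ^ i) \<le> x" "x < (\<Sum>i<n. of_int (e i) * \<beta> ^ i) + 1"
    by blast
  have "0 \<le> (\<Sum>i<n. of_int (e i) * \<beta> ^ i)" using e(1) \<beta> by (intro sum_nonneg) auto
  moreover from this have "(\<Sum>i<n. of_int (e i) * \<beta> ^ i) \<in> beta_integers \<beta>"
    using e by (intro beta_integerI[OF \<beta>, where n = n and e = e]) auto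
  ultimately show ?thesis using that e by blast
qed

context perron_quadratic
begin

text \<open>A digit at a positive index contributes at most \<open>\<bar>\<beta>'\<bar> / \<beta>\<close> times as much to the conjugate,
  and the units digit is smaller than \<open>\<beta>\<close>, so it cannot compensate. The constant is the worst
  case, units digit close to \<open>\<beta>\<close> and \<open>x\<close> close to \<open>2 \<beta>\<close>.\<close>

definition conj_ratio :: real where
  "conj_ratio = (\<beta> + \<bar>of_int a - \<beta>\<bar>) / (2 * \<beta>)"

lemma conj_ratio: "0 \<le> conj_ratio" "conj_ratio < 1"
  using conj_less gt_1 by (auto simp: conj_ratio_def)

lemma conjugate_of_beta_integer:
  assumes "x \<in> beta_integers \<beta>"
  shows "\<exists>x'. conjugates x x' \<and> \<bar>x'\<bar> \<le> \<bar>x\<bar> \<and>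
    (\<bar>x\<bar> < \<beta> \<and> x \<in> \<int> \<or> \<beta> \<le> \<bar>x\<bar> \<and> \<bar>x'\<bar> \<le> conj_ratio * \<bar>x\<bar>)"
proof -
  define \<gamma> where "\<gamma> = of_int a - \<beta>"
  have \<gamma>: "\<bar>\<gamma>\<bar> < \<beta>" using conj_less by (simp add: \<gamma>_def)
  have abs_case: "\<exists>x'. conjugates y x' \<and> \<bar>x'\<bar> \<le> y \<and> (y < \<beta> \<and> y \<in> \<int> \<or> \<beta> \<le> y \<and> \<bar>x'\<bar> \<le> conj_ratio * y)"
    if e: "\<And>i. 0 \<le> e i \<and> of_int (e i) < \<beta>" and y: "y = (\<Sum>i<n. of_int (e i) * \<beta> ^ i)"
    for y n and e :: "nat \<Rightarrow> int"
  proof (cases n)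
    case 0
    then show ?thesis using y gt_1 conjugates_of_int[of 0] by (intro exI[of _ 0]) auto
  next
    case (Suc k)
    define t where "t = (\<Sum>i<k. of_int (e (Suc i)) * \<beta> ^ i)"
    define t' where "t' = (\<Sum>i<k. of_int (e (Suc i)) * \<gamma> ^ i)"
    have pow: "conjugates (\<beta> ^ i) (\<gamma> ^ i)" for i
      using conjugates_of_int[of 1] conjugates_generator
      by (induction i) (auto simp: \<gamma>_def intro: conjugates_mult)
    have tt': "conjugates t t'" unfolding t_def t'_def
      using conjugates_of_int[of 0]
      by (induction k) (auto intro!: conjugates_add conjugates_mult conjugates_of_int pow)
    have yt: "y = of_int (e 0) + \<beta> * t"
      unfolding y Suc t_def by (simp add: sum.lessThan_Suc_shift sum_distrib_left mult_ac del: sum.lessThan_Suc)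
    define y' where "y' = of_int (e 0) + \<gamma> * t'"
    have yy': "conjugates y y'" unfolding yt y'_def
      using conjugates_generator tt' by (auto simp: \<gamma>_def intro!: conjugates_add conjugates_mult conjugates_of_int)
    have t0: "0 \<le> t" unfolding t_def using e gt_1 by (intro sum_nonneg) auto
    have "\<bar>t'\<bar> \<le> (\<Sum>i<k. \<bar>of_int (e (Suc i)) * \<gamma> ^ i\<bar>)" unfolding t'_def by (rule sum_abs)
    also have "\<dots> \<le> t" unfolding t_def
    proof (rule sum_mono)
      fix i
      have "\<bar>\<gamma>\<bar> ^ i \<le> \<beta> ^ i" using \<gamma> by (intro power_mono) auto
      then show "\<bar>of_int (e (Suc i)) * \<gamma> ^ i\<bar> \<le> of_int (e (Suc i)) * \<beta> ^ i"
        using e[of "Suc i"] by (simp add: abs_mult power_abs mult_left_mono)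
    qed
    finally have t't: "\<bar>t'\<bar> \<le> t" .
    have "\<bar>y'\<bar> \<le> of_int (e 0) + \<bar>\<gamma> * t'\<bar>" unfolding y'_def using e[of 0] by linarith
    also have "\<bar>\<gamma> * t'\<bar> \<le> \<bar>\<gamma>\<bar> * t" unfolding abs_mult using t't by (intro mult_left_mono) auto
    finally have y': "\<bar>y'\<bar> \<le> of_int (e 0) + \<bar>\<gamma>\<bar> * t" by simp
    have "\<bar>\<gamma>\<bar> * t \<le> \<beta> * t" using \<gamma> t0 by (intro mult_right_mono) auto
    then have y'y: "\<bar>y'\<bar> \<le> y" using y' yt by linarith
    show ?thesis
    proof (cases "\<forall>i<k. e (Suc i) = 0")
      case True
      then have "y = of_int (e 0)" unfolding yt t_def by simp
      then show ?thesis using yy' y'y e[of 0] by auto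
    next
      case False
      then obtain j where j: "j < k" "e (Suc j) \<noteq> 0" by blast
      have "1 \<le> of_int (e (Suc j)) * \<beta> ^ j"
      proof -
        have "1 \<le> (of_int (e (Suc j)) :: real)" using e[of "Suc j"] j by auto
        moreover have "1 \<le> \<beta> ^ j" using gt_1 by simp
        ultimately have "1 * 1 \<le> of_int (e (Suc j)) * \<beta> ^ j" by (intro mult_mono) auto
        then show ?thesis by simp
      qed
      also have "\<dots> \<le> t" unfolding t_def
        using j e gt_1 by (intro member_le_sum) auto
      finally have t1: "1 \<le> t" .
      have \<beta>t: "\<beta> * 1 \<le> \<beta> * t" using t1 gt_1 by (intro mult_left_mono) auto
      moreover have "0 \<le> real_of_int (e 0)" using e[of 0] by simp
      ultimately have "\<beta> \<le> y" using yt by linarith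
      moreover have "\<bar>y'\<bar> \<le> conj_ratio * y"
      proof -
        have e0: "of_int (e 0) \<le> \<beta> * t" using conjunct2[OF e[of 0]] \<beta>t by linarith
        have "0 \<le> (\<beta> - \<bar>\<gamma>\<bar>) * (\<beta> * t - of_int (e 0))" using \<gamma> e0 by (intro mult_nonneg_nonneg) auto
        then have "(of_int (e 0) + \<bar>\<gamma>\<bar> * t) * (2 * \<beta>) \<le> (\<beta> + \<bar>\<gamma>\<bar>) * y"
          unfolding yt by (simp add: algebra_simps)
        then have "of_int (e 0) + \<bar>\<gamma>\<bar> * t \<le> conj_ratio * y"
          using gt_1 by (simp add: conj_ratio_def \<gamma>_def pos_le_divide_eq)
        then show ?thesis using y' by linarith
      qed
      ultimately show ?thesis using yy' y'y by blast
    qed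
  qed
  obtain e :: "nat \<Rightarrow> int" and n where e: "\<And>i. 0 \<le> e i \<and> of_int (e i) < \<beta>"
      "\<bar>x\<bar> = (\<Sum>i<n. of_int (e i) * \<beta> ^ i)"
    by (rule beta_integer_digits[OF assms]) blast
  obtain x' where x': "conjugates \<bar>x\<bar> x'" "\<bar>x'\<bar> \<le> \<bar>x\<bar>"
      "\<bar>x\<bar> < \<beta> \<and> \<bar>x\<bar> \<in> \<int> \<or> \<beta> \<le> \<bar>x\<bar> \<and> \<bar>x'\<bar> \<le> conj_ratio * \<bar>x\<bar>"
    using abs_case[OF e] by blast
  show ?thesis
  proof (cases "0 \<le> x")
    case True
    then show ?thesis using x' by auto
  next
    case False
    then have "conjugates x (- x')" using conjugates_uminus[OF x'(1)] by simp
    then show ?thesis using x' False by (intro exI[of _ "- x'"]) auto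
  qed
qed

text \<open>Local finiteness turns the supremum of the \<open>\<beta>\<close>-integers below \<open>x\<close> into a maximum; below a negative
  \<open>x\<close> there is one because the set is symmetric and unbounded above.\<close>

lemma beta_floor:
  shows "beta_floor \<beta> x \<in> beta_integers \<beta>" "beta_floor \<beta> x \<le> x"
    "y \<in> beta_integers \<beta> \<Longrightarrow> y \<le> x \<Longrightarrow> y \<le> beta_floor \<beta> x"
proof -
  have "\<exists>l\<in>beta_integers \<beta>. l \<le> x"
  proof -
    obtain y where "y \<in> beta_integers \<beta>" "\<bar>x\<bar> + 1 < y + 1"
      using beta_integer_below[OF gt_1, of "\<bar>x\<bar> + 1"] by auto
    then show ?thesis by (intro bexI[of _ "- y"]) (auto simp: uminus_in_beta_integers)
  qed
  then obtain l where l: "l \<in> beta_integers \<beta>" "l \<le> x" by blast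
  define S where "S = {y \<in> beta_integers \<beta>. l \<le> y \<and> y \<le> x}"
  have "S \<subseteq> {z. \<bar>z\<bar> \<le> \<bar>l\<bar> + \<bar>x\<bar> \<and> (\<exists>x'. conjugates z x' \<and> \<bar>x'\<bar> \<le> \<bar>z\<bar>)}"
    using conjugate_of_beta_integer by (fastforce simp: S_def)
  then have fin: "finite S" using finite_bounded_conjugates finite_subset by blast
  have ne: "S \<noteq> {}" using l by (auto simp: S_def)
  have Max: "Max S \<in> beta_integers \<beta>" "Max S \<le> x" using Max_in[OF fin ne] by (auto simp: S_def)
  have ge: "y \<le> Max S" if "y \<in> beta_integers \<beta>" "y \<le> x" for y
  proof (cases "l \<le> y")
    case True
    then show ?thesis using that fin by (intro Max_ge) (auto simp: S_def)
  next
    case False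
    then show ?thesis using Max_ge[OF fin, of l] l by (simp add: S_def)
  qed
  have "beta_floor \<beta> x = Max S" unfolding beta_floor_def
    by (rule Greatest_equality) (use Max ge in auto)
  then show "beta_floor \<beta> x \<in> beta_integers \<beta>" "beta_floor \<beta> x \<le> x"
    "y \<in> beta_integers \<beta> \<Longrightarrow> y \<le> x \<Longrightarrow> y \<le> beta_floor \<beta> x"
    using Max ge by auto
qed

lemma less_beta_floor_plus_1:
  assumes "0 \<le> x" shows "x < beta_floor \<beta> x + 1"
proof -
  obtain y where "y \<in> beta_integers \<beta>" "y \<le> x" "x < y + 1"
    using beta_integer_below[OF gt_1 assms] by blast
  then show ?thesis using beta_floor(3)[of y x] by linarith
qed

lemma beta_floor_eq_floor:
  assumes "0 \<le> x" "x < \<beta>" shows "beta_floor \<beta> x = of_int \<lfloor>x\<rfloor>"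
proof -
  have "0 \<le> real_of_int \<lfloor>x\<rfloor>" using assms by simp
  then have m: "\<bar>of_int \<lfloor>x\<rfloor> :: real\<bar> < \<beta>" using assms of_int_floor_le[of x] by linarith
  have ge: "of_int \<lfloor>x\<rfloor> \<le> beta_floor \<beta> x"
    using of_int_in_beta_integers[OF gt_1 m] by (intro beta_floor(3)) auto
  have "\<bar>beta_floor \<beta> x\<bar> < \<beta>"

    using beta_floor(2)[of x] order_trans[OF \<open>0 \<le> real_of_int \<lfloor>x\<rfloor>\<close> ge] assms by simp
  then obtain m where "beta_floor \<beta> x = of_int m"
    using conjugate_of_beta_integer[OF beta_floor(1)[of x]] by (auto elim: Ints_cases)
  moreover from this have "m \<le> \<lfloor>x\<rfloor>" using beta_floor(2)[of x] by (simp add: le_floor_iff)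
  ultimately show ?thesis using ge by simp
qed

end

section \<open>The criterion for property (CFF)\<close>

context perron_quadratic
begin

lemma integral_fraction:
  assumes "x \<in> rat_adjoin \<beta>"
  obtains u u' v v' where "conjugates u u'" "conjugates v v'" "0 < v" "x = u / v"
proof -
  obtain r s where x: "x = of_rat r + of_rat s * \<beta>" using assms unfolding rat_adjoin_eq by blast
  obtain p q where r: "r = of_int p / of_int q" "q > 0"
    by (metis quotient_of_div quotient_of_denom_pos surj_pair)
  obtain k l where s: "s = of_int k / of_int l" "l > 0"
    by (metis quotient_of_div quotient_of_denom_pos surj_pair)
  have "conjugates (of_int (p * l) + of_int (k * q) * \<beta>) (of_int (p * l) + of_int (k * q) * (of_int a - \<beta>))"
    unfolding conjugates_def by blast
  moreover have "0 < real_of_int (q * l)" using r(2) s(2) by simp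
  moreover have "x = of_int p / of_int q + of_int k / of_int l * \<beta>"
    by (simp add: x r(1) s(1) of_rat_divide)
  then have "x = (of_int (p * l) + of_int (k * q) * \<beta>) / of_int (q * l)"
    using r(2) s(2) by (simp add: field_simps)
  ultimately show ?thesis using that conjugates_of_int by blast
qed

text \<open>Run the Euclidean algorithm \<open>f\<^sub>n\<^sub>+\<^sub>2 = f\<^sub>n - a\<^sub>n f\<^sub>n\<^sub>+\<^sub>1\<close> in \<open>\<int>[\<beta>]\<close> on numerator and denominator of
  \<open>\<xi>\<^sub>0\<close>, so \<open>\<xi>\<^sub>n = f\<^sub>n / f\<^sub>n\<^sub>+\<^sub>1\<close>. With \<open>Q\<^sub>n\<^sub>+\<^sub>2 = Q\<^sub>n + a\<^sub>n Q\<^sub>n\<^sub>+\<^sub>1\<close>, the quantity \<open>f\<^sub>n Q\<^sub>n\<^sub>+\<^sub>1 + f\<^sub>n\<^sub>+\<^sub>1 Q\<^sub>n\<close> is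
  constant, so \<open>f\<^sub>n\<close> is at most a constant over \<open>Q\<^sub>n\<close>, while the conjugates satisfy
  \<open>\<bar>f\<^sub>n'\<bar> \<le> C Q\<^sub>n\<close>. Every \<open>n\<close> with \<open>\<bar>a\<^sub>n'\<bar> \<le> c a\<^sub>n\<close> improves \<open>C\<close> by a fixed factor. Infinitely many
  such \<open>n\<close> would drive the nonzero integers \<open>f\<^sub>n f\<^sub>n'\<close> to 0.\<close>

lemma conjugates_not_infinitely_often_small:
  fixes \<xi> \<alpha> \<alpha>' :: "nat \<Rightarrow> real"
  assumes \<xi>0: "\<xi> 0 \<in> rat_adjoin \<beta>" and step: "\<And>n. \<xi> n = \<alpha> n + 1 / \<xi> (Suc n)" and gt1: "\<And>n. 1 < \<xi> n"
    and \<alpha>: "\<And>n. conjugates (\<alpha> n) (\<alpha>' n)" "\<And>n. 1 \<le> \<alpha> n" "\<And>n. \<bar>\<alpha>' n\<bar> \<le> \<alpha> n"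
    and c: "0 \<le> c" "c < 1"
  shows "\<not> (\<exists>\<^sub>\<infinity>n. \<bar>\<alpha>' n\<bar> \<le> c * \<alpha> n)"
proof
  assume inf: "\<exists>\<^sub>\<infinity>n. \<bar>\<alpha>' n\<bar> \<le> c * \<alpha> n"
  obtain u u' v v' where uv: "conjugates u u'" "conjugates v v'" "0 < v" "\<xi> 0 = u / v"
    using integral_fraction[OF \<xi>0] .
  \<comment> \<open>Pairs of consecutive values make the second-order recurrences primitive recursive.\<close>
  define F where "F = rec_nat (u, v) (\<lambda>n (x, y). (y, x - \<alpha> n * y))"
  define F' where "F' = rec_nat (u', v') (\<lambda>n (x, y). (y, x - \<alpha>' n * y))"
  define R where "R = rec_nat (1, 1) (\<lambda>n (x, y). (y, x + \<alpha> n * y))"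
  define f where "f n = fst (F n)" for n
  define f' where "f' n = fst (F' n)" for n
  define Q where "Q n = fst (R n)" for n
  have f: "f 0 = u" "f (Suc 0) = v" "f (Suc (Suc n)) = f n - \<alpha> n * f (Suc n)" for n
    by (simp_all add: f_def F_def split: prod.split)
  have f': "f' 0 = u'" "f' (Suc 0) = v'" "f' (Suc (Suc n)) = f' n - \<alpha>' n * f' (Suc n)" for n
    by (simp_all add: f'_def F'_def split: prod.split)
  have Q: "Q 0 = 1" "Q (Suc 0) = 1" "Q (Suc (Suc n)) = Q n + \<alpha> n * Q (Suc n)" for n
    by (simp_all add: Q_def R_def split: prod.split)

  have fpos: "f n = \<xi> n * f (Suc n) \<and> 0 < f (Suc n)" for n
  proof (induction n)
    case 0
    then show ?case using uv by (simp add: f)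
  next
    case (Suc n)
    have "f (Suc (Suc n)) = (\<xi> n - \<alpha> n) * f (Suc n)" using Suc by (simp add: f algebra_simps)
    also have "\<xi> n - \<alpha> n = 1 / \<xi> (Suc n)" using step[of n] by simp
    finally have *: "f (Suc (Suc n)) = f (Suc n) / \<xi> (Suc n)" by simp
    have "0 < \<xi> (Suc n)" using gt1[of "Suc n"] by simp
    then show ?case using * Suc by simp
  qed
  have conj: "conjugates (f n) (f' n) \<and> conjugates (f (Suc n)) (f' (Suc n))" for n
  proof (induction n)
    case (Suc n)
    then have "conjugates (f n + - (\<alpha> n * f (Suc n))) (f' n + - (\<alpha>' n * f' (Suc n)))"
      by (intro conjugates_add conjugates_uminus conjugates_mult \<alpha>(1)) auto
    then show ?case using Suc by (simp add: f f')
  qed (simp add: f f' uv)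
  have Qpos: "1 \<le> Q n \<and> Q n \<le> Q (Suc n)" for n
  proof (induction n)
    case (Suc n)
    then have "Q (Suc n) \<le> \<alpha> n * Q (Suc n)"
      using mult_right_mono[OF \<alpha>(2)[of n], of "Q (Suc n)"] by simp
    then show ?case using Suc unfolding Q by linarith
  qed (simp add: Q)
  have inv: "f n * Q (Suc n) + f (Suc n) * Q n = u + v" for n
  proof (induction n)
    case (Suc n)
    have "f (Suc n) * Q (Suc (Suc n)) + f (Suc (Suc n)) * Q (Suc n) = f n * Q (Suc n) + f (Suc n) * Q n"
      by (simp add: f Q algebra_simps)
    then show ?case using Suc by simp
  qed (simp add: f Q)

  have upper: "f (Suc n) * Q (Suc n) \<le> u + v" for n
  proof -
    have "f (Suc n) * Q (Suc n) \<le> f (Suc n) * Q (Suc (Suc n))"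
      using Qpos[of "Suc n"] fpos[of n] by (intro mult_left_mono) auto
    moreover have "0 \<le> f (Suc (Suc n)) * Q (Suc n)"
      using Qpos[of "Suc n"] fpos[of "Suc n"] by (intro mult_nonneg_nonneg) auto
    ultimately show ?thesis using inv[of "Suc n"] by linarith
  qed

  define bd where "bd \<rho> n \<longleftrightarrow> \<bar>f' n\<bar> \<le> \<rho> * Q n \<and> \<bar>f' (Suc n)\<bar> \<le> \<rho> * Q (Suc n)" for \<rho> n
  \<comment> \<open>One step with \<open>\<bar>f'\<^sub>n\<^sub>+\<^sub>1\<bar>\<close> or \<open>\<bar>\<alpha>'\<^sub>n\<bar>\<close> smaller by the factor \<open>s\<close>; the weight of this term in \<open>Q\<^sub>n\<^sub>+\<^sub>2\<close>
    is at least one half.\<close>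
  have gain: "\<bar>f' (Suc (Suc n))\<bar> \<le> \<rho> * (1 - (1 - s) / 2) * Q (Suc (Suc n))"
    if "0 \<le> \<rho>" "s \<le> 1" "\<bar>f' n\<bar> \<le> \<rho> * Q n" "\<bar>\<alpha>' n * f' (Suc n)\<bar> \<le> s * (\<rho> * (\<alpha> n * Q (Suc n)))"
    for n \<rho> s
  proof -
    have "\<bar>f' (Suc (Suc n))\<bar> \<le> \<rho> * Q n + s * (\<rho> * (\<alpha> n * Q (Suc n)))"
      using that(3,4) by (simp add: f')
    also have "\<dots> = \<rho> * (Q (Suc (Suc n)) - (1 - s) * (\<alpha> n * Q (Suc n)))"
      by (simp add: Q algebra_simps)
    also have "\<dots> \<le> \<rho> * (Q (Suc (Suc n)) - (1 - s) * (Q (Suc (Suc n)) / 2))"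
    proof -
      have "Q (Suc n) \<le> \<alpha> n * Q (Suc n)"
        using mult_right_mono[OF \<alpha>(2)[of n], of "Q (Suc n)"] Qpos[of "Suc n"] by simp
      then have "Q (Suc (Suc n)) / 2 \<le> \<alpha> n * Q (Suc n)" using conjunct2[OF Qpos[of n]] unfolding Q by simp
      then show ?thesis using that(1,2) by (intro mult_left_mono diff_left_mono) auto
    qed
    also have "\<dots> = \<rho> * (1 - (1 - s) / 2) * Q (Suc (Suc n))" by (simp add: field_simps)
    finally show ?thesis .
  qed
  have stable: "bd \<rho> (Suc n)" if "0 \<le> \<rho>" "bd \<rho> n" for \<rho> n
  proof -
    have "\<bar>\<alpha>' n * f' (Suc n)\<bar> \<le> \<alpha> n * (\<rho> * Q (Suc n))"
      unfolding abs_mult using \<alpha>(3)[of n] that(2) by (intro mult_mono) (auto simp: bd_def)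
    then have "\<bar>\<alpha>' n * f' (Suc n)\<bar> \<le> 1 * (\<rho> * (\<alpha> n * Q (Suc n)))" by (simp add: mult_ac)
    from gain[OF that(1) order_refl _ this] that(2) show ?thesis by (simp add: bd_def)
  qed
  define k where "k = 1 - (1 - c) / 4"
  have k: "0 \<le> k" "k < 1" using c by (auto simp: k_def)
  have shrink: "bd (\<rho> * k) (Suc (Suc n))" if "0 \<le> \<rho>" "bd \<rho> n" "\<bar>\<alpha>' n\<bar> \<le> c * \<alpha> n" for \<rho> n
  proof -
    define s where "s = 1 - (1 - c) / 2"
    have s: "0 \<le> s" "s \<le> 1" "s \<le> k" "1 - (1 - s) / 2 = k" using c by (auto simp: s_def k_def field_simps)
    have "\<bar>\<alpha>' n * f' (Suc n)\<bar> \<le> (c * \<alpha> n) * (\<rho> * Q (Suc n))"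
      unfolding abs_mult using that by (intro mult_mono) (auto simp: bd_def)
    then have "\<bar>\<alpha>' n * f' (Suc n)\<bar> \<le> c * (\<rho> * (\<alpha> n * Q (Suc n)))" by (simp add: mult_ac)
    from gain[OF that(1) _ _ this] c that(2)
    have 1: "\<bar>f' (Suc (Suc n))\<bar> \<le> \<rho> * s * Q (Suc (Suc n))" by (simp add: bd_def s_def)
    have "\<bar>\<alpha>' (Suc n) * f' (Suc (Suc n))\<bar> \<le> \<alpha> (Suc n) * (\<rho> * s * Q (Suc (Suc n)))"
      unfolding abs_mult using \<alpha>(3)[of "Suc n"] 1 by (intro mult_mono) auto
    then have "\<bar>\<alpha>' (Suc n) * f' (Suc (Suc n))\<bar> \<le> s * (\<rho> * (\<alpha> (Suc n) * Q (Suc (Suc n))))"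
      by (simp add: mult_ac)
    from gain[OF that(1) s(2) _ this] that(2) s(4)
    have 2: "\<bar>f' (Suc (Suc (Suc n)))\<bar> \<le> \<rho> * k * Q (Suc (Suc (Suc n)))" by (simp add: bd_def)
    have "\<rho> * s * Q (Suc (Suc n)) \<le> \<rho> * k * Q (Suc (Suc n))"
      using that(1) s(3) Qpos[of "Suc (Suc n)"] by (intro mult_right_mono mult_left_mono) auto
    with 1 2 show ?thesis by (simp add: bd_def)
  qed
  define C where "C = max \<bar>u'\<bar> \<bar>v'\<bar>"
  have "\<exists>n. bd (C * k ^ j) n" for j
  proof (induction j)
    case 0
    have "bd C 0" by (simp add: bd_def f' Q C_def)
    then show ?case by auto
  next
    case (Suc j)
    then obtain n where n: "bd (C * k ^ j) n" by blast
    have C: "0 \<le> C * k ^ j" using k by (simp add: C_def)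
    obtain m where m: "n \<le> m" "\<bar>\<alpha>' m\<bar> \<le> c * \<alpha> m" using inf unfolding INFM_nat_le by blast
    from m(1) have "bd (C * k ^ j) m"
      by (induction m rule: dec_induct) (auto intro: n stable[OF C])
    from shrink[OF C this m(2)] show ?case by (auto simp: mult_ac)
  qed note small = this
  define D where "D = C * (u + v)"
  have u: "0 < u" using fpos[of 0] uv gt1[of 0] by (simp add: f)
  then have D: "0 \<le> D" using uv by (simp add: D_def C_def)
  obtain j where j: "k ^ j < 1 / (D + 1)" using real_arch_pow_inv[of "1 / (D + 1)" k] D k by auto
  obtain n where n: "bd (C * k ^ j) n" using small by blast
  have "1 \<le> \<bar>f (Suc n) * f' (Suc n)\<bar>"
    using one_le_norm conj[of n] fpos[of n] by (metis less_irrefl)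
  also have "\<dots> = f (Suc n) * \<bar>f' (Suc n)\<bar>" using fpos[of n] by (simp add: abs_mult)
  also have "\<dots> \<le> f (Suc n) * (C * k ^ j * Q (Suc n))"
    using n fpos[of n] by (intro mult_left_mono) (auto simp: bd_def)
  also have "\<dots> = C * k ^ j * (f (Suc n) * Q (Suc n))" by (simp add: mult_ac)
  also have "\<dots> \<le> C * k ^ j * (u + v)"
    using upper[of n] k by (intro mult_left_mono) (auto simp: C_def)
  also have "\<dots> = D * k ^ j" by (simp add: D_def)
  also have "\<dots> \<le> D * (1 / (D + 1))" using j D by (intro mult_left_mono) auto
  also have "\<dots> < 1" using D by simp
  finally show False by simp
qed

text \<open>By the previous lemma an infinite expansion has eventually only partial quotients smaller than
  \<open>\<beta>\<close>, which are rational integers. Then the complete quotients stay below \<open>\<beta>\<close>, itself a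
  \<open>\<beta>\<close>-integer, and the two algorithms agree.\<close>

theorem CFF_iff:
  "CFF \<beta> \<longleftrightarrow> \<not> (\<exists>x\<in>rat_adjoin \<beta>. 1 < x \<and> infinite_regular_cf x \<and> (\<forall>n. regular_cf_quotient x n < \<beta>))"
proof
  assume CFF: "CFF \<beta>"
  show "\<not> (\<exists>x\<in>rat_adjoin \<beta>. 1 < x \<and> infinite_regular_cf x \<and> (\<forall>n. regular_cf_quotient x n < \<beta>))"
  proof safe
    fix x assume x: "x \<in> rat_adjoin \<beta>" "1 < x" "infinite_regular_cf x" "\<forall>n. regular_cf_quotient x n < \<beta>"
    have gt1: "1 < regular_cf_quotient x n" for n by (rule regular_cf_quotient_gt_1[OF x(3,2)])
    have eq: "beta_cf_quotient \<beta> x n = regular_cf_quotient x n" for n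
    proof (induction n)
      case (Suc n)
      have "beta_floor \<beta> (regular_cf_quotient x n) = of_int \<lfloor>regular_cf_quotient x n\<rfloor>"
        using gt1[of n] x(4) by (intro beta_floor_eq_floor) auto
      then show ?case using Suc by simp
    qed simp
    obtain n where "beta_cf_quotient \<beta> x n \<in> beta_integers \<beta>"
      using CFF x(1) unfolding CFF_def finite_beta_cf_def by blast
    then have "regular_cf_quotient x n \<in> beta_integers \<beta>" by (simp only: eq)
    then have "regular_cf_quotient x n \<in> \<int> \<or> \<beta> \<le> \<bar>regular_cf_quotient x n\<bar>"
      using conjugate_of_beta_integer by blast
    moreover have "\<bar>regular_cf_quotient x n\<bar> < \<beta>" using gt1[of n] x(4) by simp
    ultimately show False using x(3) by (auto simp: infinite_regular_cf_def)
  qed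
next
  assume none: "\<not> (\<exists>x\<in>rat_adjoin \<beta>. 1 < x \<and> infinite_regular_cf x \<and> (\<forall>n. regular_cf_quotient x n < \<beta>))"
  show "CFF \<beta>"
  proof (rule ccontr)
    assume "\<not> CFF \<beta>"
    then obtain y where y: "y \<in> rat_adjoin \<beta>" "\<And>n. beta_cf_quotient \<beta> y n \<notin> beta_integers \<beta>"
      unfolding CFF_def finite_beta_cf_def by blast
    define q where "q = beta_cf_quotient \<beta> y"
    have q_Suc: "q (Suc n) = 1 / (q n - beta_floor \<beta> (q n))" for n by (simp add: q_def)
    have frac: "beta_floor \<beta> (q n) < q n" for n
      using beta_floor(1,2)[of "q n"] y(2)[of n] by (metis less_eq_real_def q_def)
    have pos: "0 < q (Suc n)" for n using frac[of n] by (simp add: q_Suc)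
    have q_gt1: "1 < q (Suc (Suc n))" for n
      using frac[of "Suc n"] less_beta_floor_plus_1[of "q (Suc n)"] pos[of n]
      by (subst q_Suc) (simp add: less_divide_eq)
    have qK: "q n \<in> rat_adjoin \<beta>" for n
    proof (induction n)
      case (Suc n)
      have "beta_floor \<beta> (q n) \<in> rat_adjoin \<beta>"
        using conjugate_of_beta_integer[OF beta_floor(1)] conjugates_in_rat_adjoin by blast
      with Suc show ?case unfolding q_Suc
        by (intro real_subfieldD(2,7,8)[OF real_subfield_rat_adjoin])
    qed (simp add: q_def y)
    \<comment> \<open>Two steps are skipped: \<open>q 0\<close> can be negative, in which case \<open>q 1\<close> is only known to be positive.\<close>
    define \<xi> where "\<xi> n = q (Suc (Suc n))" for n
    define \<alpha> where "\<alpha> n = beta_floor \<beta> (\<xi> n)" for n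
    have gt1: "1 < \<xi> n" for n by (simp add: \<xi>_def q_gt1)
    have step: "\<xi> n = \<alpha> n + 1 / \<xi> (Suc n)" for n
      by (simp add: \<xi>_def \<alpha>_def q_Suc[of "Suc (Suc n)"])
    have \<alpha>1: "1 \<le> \<alpha> n" for n
      using beta_floor(3)[of 1 "\<xi> n"] of_int_in_beta_integers[OF gt_1, of 1] gt_1 gt1[of n]
      by (simp add: \<alpha>_def)
    have "\<forall>n. \<exists>x'. conjugates (\<alpha> n) x' \<and> \<bar>x'\<bar> \<le> \<alpha> n \<and> (\<alpha> n < \<beta> \<and> \<alpha> n \<in> \<int> \<or> \<bar>x'\<bar> \<le> conj_ratio * \<alpha> n)"
    proof
      fix n
      have abs: "\<bar>\<alpha> n\<bar> = \<alpha> n" using \<alpha>1[of n] by simp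
      show "\<exists>x'. conjugates (\<alpha> n) x' \<and> \<bar>x'\<bar> \<le> \<alpha> n \<and> (\<alpha> n < \<beta> \<and> \<alpha> n \<in> \<int> \<or> \<bar>x'\<bar> \<le> conj_ratio * \<alpha> n)"
        using conjugate_of_beta_integer[OF beta_floor(1)[of "\<xi> n"], folded \<alpha>_def, unfolded abs] by blast
    qed
    from choice[OF this] obtain \<alpha>' where *: "\<forall>n. conjugates (\<alpha> n) (\<alpha>' n) \<and> \<bar>\<alpha>' n\<bar> \<le> \<alpha> n \<and>
        (\<alpha> n < \<beta> \<and> \<alpha> n \<in> \<int> \<or> \<bar>\<alpha>' n\<bar> \<le> conj_ratio * \<alpha> n)" by (rule exE)
    have \<alpha>': "conjugates (\<alpha> n) (\<alpha>' n)" "\<bar>\<alpha>' n\<bar> \<le> \<alpha> n"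
        "\<alpha> n < \<beta> \<or> \<bar>\<alpha>' n\<bar> \<le> conj_ratio * \<alpha> n" for n
      using spec[OF *, of n] by (simp_all, blast)
    have "\<not> (\<exists>\<^sub>\<infinity>n. \<bar>\<alpha>' n\<bar> \<le> conj_ratio * \<alpha> n)"
    proof (rule conjugates_not_infinitely_often_small[where \<xi> = \<xi>])
      show "\<xi> 0 \<in> rat_adjoin \<beta>" by (simp add: \<xi>_def qK)
    qed (fact step gt1 \<alpha>' \<alpha>1 conj_ratio)+
    then obtain N where N: "\<And>n. N \<le> n \<Longrightarrow> \<alpha> n < \<beta>" unfolding INFM_nat_le using \<alpha>'(3) by blast
    have lt: "\<xi> n < \<beta>" if "N \<le> n" for n
    proof (rule ccontr)
      assume "\<not> \<xi> n < \<beta>"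
      then have "\<beta> \<le> \<alpha> n" unfolding \<alpha>_def
        by (intro beta_floor(3) base_in_beta_integers gt_1) auto
      then show False using N[OF that] by simp
    qed
    have eq: "regular_cf_quotient (\<xi> N) n = \<xi> (N + n)" for n
    proof (induction n)
      case (Suc n)
      have "beta_floor \<beta> (\<xi> (N + n)) = of_int \<lfloor>\<xi> (N + n)\<rfloor>"
        using gt1[of "N + n"] lt[of "N + n"] by (intro beta_floor_eq_floor) auto
      then show ?case using Suc by (simp add: \<xi>_def q_Suc[of "Suc (Suc (N + n))"])
    qed simp
    have "\<xi> (N + n) \<notin> \<int>" for n
    proof
      assume "\<xi> (N + n) \<in> \<int>"
      then obtain m where m: "\<xi> (N + n) = of_int m" by (rule Ints_cases)
      have "\<xi> (N + n) \<in> beta_integers \<beta>" unfolding m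
        using gt1[of "N + n"] lt[of "N + n"] by (intro of_int_in_beta_integers gt_1) (simp add: m)
      then show False using y(2)[of "Suc (Suc (N + n))"] by (simp only: \<xi>_def q_def)
    qed
    then have "infinite_regular_cf (\<xi> N)" by (simp add: infinite_regular_cf_def eq)
    moreover have "\<forall>n. regular_cf_quotient (\<xi> N) n < \<beta>" using lt by (simp add: eq)
    moreover have "\<xi> N \<in> rat_adjoin \<beta>" by (simp add: \<xi>_def qK)
    ultimately show False using none gt1[of N] by blast
  qed
qed

end

section \<open>Square roots in quadratic fields\<close>

text \<open>A rational square root of an integer is an algebraic integer, hence an integer; there is none
  strictly between \<open>k\<close> and \<open>k + 1\<close>.\<close>

lemma sqrt_of_nat_irrational:
  fixes k m :: nat
  assumes "k\<^sup>2 < m" "m < (k + 1)\<^sup>2"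
  shows "sqrt (real m) \<notin> \<rat>"
proof
  assume "sqrt (real m) \<in> \<rat>"
  then have "sqrt (real m) \<in> \<int>"
    by (intro rational_algebraic_int_is_int algebraic_int_sqrt) auto
  then obtain n where n: "sqrt (real m) = of_int n" by (rule Ints_cases)
  have "real k < sqrt (real m)" using assms(1) by (intro real_less_rsqrt) (simp flip: of_nat_power)
  moreover have "sqrt (real m) < real k + 1"
  proof (rule real_less_lsqrt)
    have "real m < real ((k + 1)\<^sup>2)" using assms(2) by (simp only: of_nat_less_iff)
    then show "real m < (real k + 1)\<^sup>2" by (simp add: add.commute)
  qed auto
  ultimately have "int k < n" "n < int k + 1" unfolding n by linarith+
  then show False by linarith
qed

lemma sqrt_irrationals:
  "sqrt 5 \<notin> \<rat>" "sqrt 8 \<notin> \<rat>" "sqrt 13 \<notin> \<rat>" "sqrt 17 \<notin> \<rat>"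
  "sqrt 40 \<notin> \<rat>" "sqrt 65 \<notin> \<rat>" "sqrt 85 \<notin> \<rat>" "sqrt 136 \<notin> \<rat>"
  using sqrt_of_nat_irrational[of 2 5] sqrt_of_nat_irrational[of 2 8]
    sqrt_of_nat_irrational[of 3 13] sqrt_of_nat_irrational[of 4 17]
    sqrt_of_nat_irrational[of 6 40] sqrt_of_nat_irrational[of 8 65] sqrt_of_nat_irrational[of 9 85]
    sqrt_of_nat_irrational[of 11 136]
  by simp_all

text \<open>Squaring such a relation would make \<open>\<surd>d\<close>, and with it \<open>\<surd>m\<close>, rational, unless \<open>r\<close> or \<open>s\<close>
  vanishes.\<close>

lemma sqrt_not_in_quadratic_field:
  fixes m d :: nat
  assumes m: "sqrt (real m) \<notin> \<rat>" and md: "sqrt (real m * real d) \<notin> \<rat>"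
  shows "sqrt (real m) \<noteq> of_rat r + of_rat s * sqrt (real d)"
proof
  assume eq: "sqrt (real m) = of_rat r + of_rat s * sqrt (real d)"
  have "s \<noteq> 0" using eq m by auto
  have "r \<noteq> 0"
  proof
    assume "r = 0"
    then have "sqrt (real m) * sqrt (real d) = of_rat s * (sqrt (real d) * sqrt (real d))"
      using eq by simp
    also have "sqrt (real d) * sqrt (real d) = real d" by simp
    finally have "sqrt (real m * real d) = of_rat s * real d" by (simp add: real_sqrt_mult)
    then show False using md by simp
  qed
  have "real m = sqrt (real m) * sqrt (real m)" by simp
  also have "\<dots> = of_rat r * of_rat r + of_rat s * of_rat s * (sqrt (real d) * sqrt (real d))
      + 2 * of_rat r * of_rat s * sqrt (real d)"
    unfolding eq by (simp add: algebra_simps)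
  also have "sqrt (real d) * sqrt (real d) = real d" by simp
  finally have "sqrt (real d) = (real m - of_rat r * of_rat r - of_rat s * of_rat s * real d) / (2 * of_rat r * of_rat s)"
    using \<open>r \<noteq> 0\<close> \<open>s \<noteq> 0\<close> by (simp add: field_simps)
  moreover have "\<dots> \<in> \<rat>" by (intro Rats_divide Rats_diff Rats_mult Rats_of_rat Rats_of_nat) auto
  ultimately have "sqrt (real d) \<in> \<rat>" by simp
  then have "of_rat r + of_rat s * sqrt (real d) \<in> \<rat>" by (intro Rats_add Rats_mult Rats_of_rat)
  then show False using m eq by simp
qed

lemma perron_quadraticI:
  assumes a: "0 < a" and D: "0 \<le> a\<^sup>2 + 4 * b" and irr: "sqrt (of_int (a\<^sup>2 + 4 * b)) \<notin> \<rat>"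
    and \<beta>: "\<beta> = (of_int a + sqrt (of_int (a\<^sup>2 + 4 * b))) / 2" "1 < \<beta>"
  shows "perron_quadratic \<beta> a b"
proof
  define w where "w = sqrt (real_of_int (a\<^sup>2 + 4 * b))"
  have w: "0 \<le> w" "w * w = of_int a * of_int a + 4 * of_int b"
    using D by (simp_all add: w_def power2_eq_square del: of_int_add of_int_mult of_int_power)
       (simp add: power2_eq_square)
  have "w \<noteq> 0" using irr by (auto simp: w_def)
  have \<beta>w: "2 * \<beta> = of_int a + w" using \<beta> by (simp add: w_def)
  show "1 < \<beta>" by fact
  show "\<beta> \<notin> \<rat>"
  proof
    assume "\<beta> \<in> \<rat>"
    then have "2 * \<beta> - of_int a \<in> \<rat>" by (intro Rats_diff Rats_mult) auto
    then show False using irr \<beta>w by (simp add: w_def)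
  qed
  have "(2 * \<beta>) * (2 * \<beta>) = 2 * of_int a * (2 * \<beta>) + 4 * of_int b"
    unfolding \<beta>w using w(2) by (simp add: algebra_simps)
  then show "\<beta>\<^sup>2 = of_int a * \<beta> + of_int b" by (simp add: power2_eq_square)
  show "\<bar>of_int a - \<beta>\<bar> < \<beta>" using \<beta>w w(1) \<open>w \<noteq> 0\<close> a by (simp add: abs_less_iff)
qed

context perron_quadratic
begin

lemma a_pos: "0 < a"
proof -
  have "0 < real_of_int a" using conj_less by linarith
  then show ?thesis by simp
qed

lemma sqrt_discriminant: "sqrt (of_int (a\<^sup>2 + 4 * b)) = 2 * \<beta> - of_int a" "2 * \<beta> - of_int a > 0"
proof -
  show pos: "2 * \<beta> - of_int a > 0" using conj_less by linarith
  have "(2 * \<beta> - of_int a)\<^sup>2 = of_int (a\<^sup>2 + 4 * b)"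
    using quadratic by (simp add: power2_eq_square algebra_simps)
  then show "sqrt (of_int (a\<^sup>2 + 4 * b)) = 2 * \<beta> - of_int a" using pos by (simp add: real_sqrt_unique)
qed

lemma sqrt_discriminant_irrational: "sqrt (of_int (a\<^sup>2 + 4 * b)) \<notin> \<rat>"
proof
  assume "sqrt (of_int (a\<^sup>2 + 4 * b)) \<in> \<rat>"
  then have "(sqrt (of_int (a\<^sup>2 + 4 * b)) + of_int a) / 2 \<in> \<rat>"
    by (intro Rats_divide Rats_add) auto
  then show False using irrational unfolding sqrt_discriminant by simp
qed

lemma closed_form: "\<beta> = (of_int a + sqrt (of_int (a\<^sup>2 + 4 * b))) / 2"
  unfolding sqrt_discriminant by simp

lemma discriminant_pos: "0 < a\<^sup>2 + 4 * b"
proof -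
  have "0 < sqrt (of_int (a\<^sup>2 + 4 * b))" using sqrt_discriminant by simp
  then show ?thesis by (simp only: real_sqrt_gt_0_iff of_int_0_less_iff)
qed

lemma rat_adjoin_sqrt:
  "x \<in> rat_adjoin \<beta> \<longleftrightarrow> (\<exists>r s. x = of_rat r + of_rat s * sqrt (of_int (a\<^sup>2 + 4 * b)))"
proof -
  have "(\<exists>s t. x = of_rat s + of_rat t * (2 * \<beta> - of_int a))" if x: "x = of_rat p + of_rat q * \<beta>" for p q
  proof (intro exI)
    show "x = of_rat (p + q * of_int a / 2) + of_rat (q / 2) * (2 * \<beta> - of_int a)"
      by (simp add: x of_rat_add of_rat_mult of_rat_divide algebra_simps)
  qed
  moreover have "\<exists>p q. x = of_rat p + of_rat q * \<beta>" if x: "x = of_rat s + of_rat t * (2 * \<beta> - of_int a)" for s t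
  proof (intro exI)
    show "x = of_rat (s - t * of_int a) + of_rat (2 * t) * \<beta>"
      by (simp add: x of_rat_diff of_rat_mult algebra_simps)
  qed
  ultimately show ?thesis unfolding sqrt_discriminant rat_adjoin_eq by blast
qed

lemma sqrt_notin_rat_adjoin:
  fixes m d :: nat
  assumes "sqrt (real m) \<notin> \<rat>" "sqrt (real m * real d) \<notin> \<rat>" "a\<^sup>2 + 4 * b = int d"
  shows "sqrt (real m) \<notin> rat_adjoin \<beta>"
  using sqrt_not_in_quadratic_field[OF assms(1,2)] unfolding rat_adjoin_sqrt assms(3) by simp

section \<open>The four numbers with property (CFF)\<close>

lemma golden_if_small_quotients:
  assumes x: "infinite_regular_cf x" "1 < x" "\<And>n. regular_cf_quotient x n < \<beta>"
    and ones: "\<And>n. partial_quotient x n < 2"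
  shows "x = (1 + sqrt 5) / 2"
proof -
  have "regular_cf_quotient x 0 = (1 + sqrt (1\<^sup>2 + 4)) / 2"
  proof (rule constant_cf_value[where x = "regular_cf_quotient x"])
    fix n
    have "partial_quotient x n = 1" using partial_quotient_ge_1[OF x(1,2), of n] ones[of n] by simp
    then show "regular_cf_quotient x n = 1 + 1 / regular_cf_quotient x (Suc n)"
      using regular_cf_step(1)[OF x(1), of n] by simp
    show "1 < regular_cf_quotient x n" by (rule regular_cf_quotient_gt_1[OF x(1,2)])
    show "regular_cf_quotient x n < \<beta>" by (rule x(3))
  qed simp
  then show ?thesis by simp
qed

text \<open>If \<open>\<beta> \<le> 2 + 1/\<beta>\<close>, a partial quotient \<open>\<ge> 2\<close> would make the complete quotient exceed \<open>\<beta>\<close>.\<close>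

lemma golden_if_quotients_less:
  assumes \<beta>: "\<beta> \<le> 2 + 1 / \<beta>" and x: "infinite_regular_cf x" "1 < x" "\<And>n. regular_cf_quotient x n < \<beta>"
  shows "x = (1 + sqrt 5) / 2"
proof (rule golden_if_small_quotients[OF x])
  fix n
  define y where "y = regular_cf_quotient x (Suc n)"
  have y: "1 < y" "y < \<beta>" unfolding y_def by (rule regular_cf_quotient_gt_1[OF x(1,2)], rule x(3))
  have "1 / \<beta> < 1 / y" using y by (intro divide_strict_left_mono) auto
  moreover have "of_int (partial_quotient x n) + 1 / y < \<beta>"
    using regular_cf_step(1)[OF x(1), of n] x(3)[of n] by (simp add: y_def)
  ultimately have "real_of_int (partial_quotient x n) < 2" using \<beta> by linarith
  then show "partial_quotient x n < 2" by simp
qed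

text \<open>For \<open>\<beta> = (1 + \<surd>17) / 2\<close> two consecutive partial quotients 2, 1 give a complete quotient of
  at least \<open>2 + (\<beta> + 1) / (2 \<beta> + 1) \<ge> \<beta>\<close>. So a partial quotient 2 is followed by 2 forever.\<close>

lemma sqrt17_digit_2_persists:
  assumes ab: "a = 1" "b = 4" and x: "infinite_regular_cf x" "1 < x" "\<And>n. regular_cf_quotient x n < \<beta>"
    and 2: "2 \<le> partial_quotient x n"
  shows "2 \<le> partial_quotient x (Suc n)"
proof (rule ccontr)
  assume "\<not> ?thesis"
  then have one: "partial_quotient x (Suc n) = 1" using partial_quotient_ge_1[OF x(1,2), of "Suc n"] by simp
  define q where "q = regular_cf_quotient x"
  have gt1: "1 < q k" for k unfolding q_def by (rule regular_cf_quotient_gt_1[OF x(1,2)])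
  have step: "q k = of_int (partial_quotient x k) + 1 / q (Suc k)" for k
    unfolding q_def by (rule regular_cf_step(1)[OF x(1)])
  have quad: "\<beta> * \<beta> = \<beta> + 4" using quadratic by (simp add: ab power2_eq_square)
  have big: "5 / 2 \<le> \<beta>"
  proof (rule ccontr)
    assume "\<not> ?thesis"
    then have "\<beta> * (\<beta> - 1) \<le> 5 / 2 * (3 / 2)" using gt_1 by (intro mult_mono) auto
    then show False using quad by (simp add: algebra_simps)
  qed
  have "1 / \<beta> \<le> 1 / q (n + 3)"
    using gt1[of "n + 3"] x(3)[of "n + 3"] by (intro divide_left_mono) (auto simp: q_def)
  then have "1 + 1 / \<beta> \<le> q (n + 2)"
    using step[of "n + 2"] partial_quotient_ge_1[OF x(1,2), of "n + 2"] by (simp add: numeral_3_eq_3)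
  then have "1 / q (n + 2) \<le> 1 / (1 + 1 / \<beta>)"
    using gt_1 by (intro divide_left_mono mult_pos_pos) (auto intro: add_pos_pos order_less_trans[OF zero_less_one gt1])
  then have "q (Suc n) \<le> 1 + 1 / (1 + 1 / \<beta>)" using step[of "Suc n"] one by simp
  then have "1 / (1 + 1 / (1 + 1 / \<beta>)) \<le> 1 / q (Suc n)"
    using gt1[of "Suc n"] gt_1 by (intro divide_left_mono mult_pos_pos) (auto intro: add_pos_pos)
  also have "1 / (1 + 1 / (1 + 1 / \<beta>)) = (\<beta> + 1) / (2 * \<beta> + 1)"
    using gt_1 by (simp add: field_simps)
  finally have "2 + (\<beta> + 1) / (2 * \<beta> + 1) \<le> q n" using step[of n] 2 by linarith
  moreover have "\<beta> \<le> 2 + (\<beta> + 1) / (2 * \<beta> + 1)"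
  proof -
    have "(\<beta> - 2) * (2 * \<beta> + 1) \<le> \<beta> + 1" using quad big by (simp add: algebra_simps)
    then have "\<beta> - 2 \<le> (\<beta> + 1) / (2 * \<beta> + 1)" using gt_1 by (simp add: pos_le_divide_eq)
    then show ?thesis by simp
  qed
  ultimately show False using x(3)[of n] by (simp add: q_def)
qed

lemma CFF_of_listed:
  assumes "(a, b) \<in> {(1, 1), (2, 1), (1, 3), (1, 4)}"
  shows "CFF \<beta>"
  unfolding CFF_iff
proof safe
  fix x assume x: "x \<in> rat_adjoin \<beta>" "1 < x" "infinite_regular_cf x" "\<forall>n. regular_cf_quotient x n < \<beta>"
  have lt: "regular_cf_quotient x n < \<beta>" for n using x(4) by simp
  note K = real_subfieldD[OF real_subfield_rat_adjoin[of \<beta>]] of_int_in_real_subfield[OF real_subfield_rat_adjoin[of \<beta>]]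
  have golden: "sqrt 5 \<in> rat_adjoin \<beta>" if "y \<in> rat_adjoin \<beta>" "y = (1 + sqrt 5) / 2" for y
  proof -
    have "of_int 2 * y - of_int 1 \<in> rat_adjoin \<beta>" using that(1) by (intro K)
    then show ?thesis by (simp add: that(2) add_divide_distrib)
  qed
  have small: "\<beta> \<le> 2 + 1 / \<beta>" if "(a, b) \<in> {(1, 1), (2, 1), (1, 3)}"
  proof -
    have "\<beta> * \<beta> \<le> 2 * \<beta> + 1"
    proof (cases "(a, b) = (1, 3)")
      case True
      then have quad: "\<beta> * \<beta> = \<beta> + 3" using quadratic by (simp add: power2_eq_square)
      have "2 \<le> \<beta>"
      proof (rule ccontr)
        assume "\<not> ?thesis"
        then have "\<beta> * (\<beta> - 1) \<le> 2 * 1" using gt_1 by (intro mult_mono) auto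
        then show False using quad by (simp add: algebra_simps)
      qed
      then show ?thesis using quad by simp
    next
      case False
      then show ?thesis using that quadratic gt_1 by (auto simp: power2_eq_square)
    qed
    then have "(\<beta> - 2) * \<beta> \<le> 1" by (simp add: algebra_simps)
    then have "\<beta> - 2 \<le> 1 / \<beta>" using gt_1 by (simp add: pos_le_divide_eq)
    then show ?thesis by simp
  qed
  from assms consider "a = 1" "b = 1" | "a = 2" "b = 1" | "a = 1" "b = 3" | "a = 1" "b = 4" by auto
  then show False
  proof cases
    case 1
    then have "x = \<beta>" using golden_if_quotients_less[OF small x(3,2) lt] closed_form by simp
    then show False using lt[of 0] by simp
  next
    case 2
    have "sqrt (real 5) \<notin> rat_adjoin \<beta>"
      by (rule sqrt_notin_rat_adjoin[where d = 8]) (use 2 sqrt_irrationals in auto)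
    then show False using golden[OF x(1)] golden_if_quotients_less[OF small x(3,2) lt] 2 by simp
  next
    case 3
    have "sqrt (real 5) \<notin> rat_adjoin \<beta>"
      by (rule sqrt_notin_rat_adjoin[where d = 13]) (use 3 sqrt_irrationals in auto)
    then show False using golden[OF x(1)] golden_if_quotients_less[OF small x(3,2) lt] 3 by simp
  next
    case 4
    have 5: "sqrt (real 5) \<notin> rat_adjoin \<beta>" and 8: "sqrt (real 8) \<notin> rat_adjoin \<beta>"
      by (rule sqrt_notin_rat_adjoin[where d = 17]; use 4 sqrt_irrationals in auto)+
    have \<beta>3: "\<beta> < 3"
    proof (rule ccontr)
      assume "\<not> ?thesis"
      then have "3 * 2 \<le> \<beta> * (\<beta> - 1)" by (intro mult_mono) auto
      then show False using quadratic 4 by (simp add: power2_eq_square algebra_simps)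
    qed
    show False
    proof (cases "\<forall>n. partial_quotient x n < 2")
      case True
      then show False using golden[OF x(1)] golden_if_small_quotients[OF x(3,2) lt] 5 by simp
    next
      case False
      then obtain N where N: "2 \<le> partial_quotient x N" by (auto simp: not_less)
      have ge: "2 \<le> partial_quotient x (N + n)" for n
        by (induction n) (use N sqrt17_digit_2_persists[OF 4 x(3,2) lt] in auto)
      have 2: "partial_quotient x (N + n) = 2" for n
      proof -
        have "partial_quotient x (N + n) < 3"
          using lt[of "N + n"] \<beta>3 by (simp add: partial_quotient_def floor_less_iff)
        then show ?thesis using ge[of n] by linarith
      qed
      define y where "y n = regular_cf_quotient x (N + n)" for n
      have "y 0 = (2 + sqrt (2\<^sup>2 + 4)) / 2"
      proof (rule constant_cf_value[where B = \<beta>])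
        fix n
        show "y n = 2 + 1 / y (Suc n)" using regular_cf_step(1)[OF x(3), of "N + n"] 2[of n] by (simp add: y_def)
        show "1 < y n" "y n < \<beta>" using regular_cf_quotient_gt_1[OF x(3,2)] lt by (auto simp: y_def)
      qed simp
      then have "sqrt 8 = of_int 2 * y 0 - of_int 2" by simp
      moreover have "y 0 \<in> rat_adjoin \<beta>" unfolding y_def
        by (rule regular_cf_quotient_in_subfield[OF real_subfield_rat_adjoin x(1)])
      then have "of_int 2 * y 0 - of_int 2 \<in> rat_adjoin \<beta>" by (intro K)
      ultimately show False using 8 by simp
    qed
  qed
qed

section \<open>Quadratic Perron numbers without property (CFF)\<close>

text \<open>Complete quotients are at most \<open>1 + \<surd>3\<close> when all digits are 1 or 2, so only the value
  \<open>\<beta> = 1 + \<surd>3\<close> itself requires that none of them equals \<open>\<beta>\<close>.\<close>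

lemma not_CFF_if_cf12:
  assumes x: "x \<in> rat_adjoin \<beta>" "infinite_regular_cf x" "\<And>n. partial_quotient x n \<in> {1, 2}"
    and \<beta>: "1 + sqrt 3 \<le> \<beta>" and ne: "\<And>n. 1 + sqrt 3 = \<beta> \<Longrightarrow> regular_cf_quotient x n \<noteq> \<beta>"
  shows "\<not> CFF \<beta>"
proof -
  have "1 \<le> x" using x(3)[of 0] by (auto simp: partial_quotient_def floor_eq_iff)
  moreover have "x \<noteq> 1" using x(2) Ints_1 by (metis infinite_regular_cf_def regular_cf_quotient.simps(1))
  ultimately have "1 < x" by simp
  moreover have "regular_cf_quotient x n < \<beta>" for n
  proof -
    have "regular_cf_quotient x n \<le> 1 + sqrt 3"
    proof (rule cf12_le_1_plus_sqrt3)
      show "infinite_regular_cf (regular_cf_quotient x n)" by (rule infinite_regular_cf_shift[OF x(2)])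
      show "1 < regular_cf_quotient x n" by (rule regular_cf_quotient_gt_1[OF x(2) \<open>1 < x\<close>])
      show "partial_quotient (regular_cf_quotient x n) m \<in> {1, 2}" for m
        using x(3) by (simp add: partial_quotient_def regular_cf_quotient_shift)
    qed
    then show ?thesis using \<beta> ne[of n] by force
  qed
  ultimately show ?thesis unfolding CFF_iff using x by blast
qed

text \<open>The number provided by the conjecture has complete quotients below 3.\<close>

lemma not_CFF_if_Mercat:
  assumes Mercat: Mercat_conjecture and \<beta>: "3 \<le> \<beta>"
  shows "\<not> CFF \<beta>"
proof -
  obtain x where x: "x \<in> rat_adjoin \<beta>" "infinite_regular_cf x" "\<And>n. partial_quotient x n \<in> {1, 2}"
    using Mercat real_quadratic_field_rat_adjoin unfolding Mercat_conjecture_def by blast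
  have "sqrt 3 < 2" by (rule real_less_lsqrt) auto
  then show ?thesis using \<beta> by (intro not_CFF_if_cf12[OF x]) auto
qed

text \<open>The periodic continued fraction of a word \<open>w\<close> lies in \<open>\<rat>(\<surd>d)\<close> iff \<open>\<surd>d\<close> generates the field of the
  eigenvalues of its matrix, which are units. The words below were found by enumerating words in
  1 and 2 whose matrix has the trace of a unit of \<open>\<rat>(\<surd>3)\<close> or \<open>\<rat>(\<surd>21)\<close>. The obvious choice \<open>[1,2]\<close> for
  \<open>\<rat>(\<surd>3)\<close> fails because it has \<open>\<beta> = 1 + \<surd>3\<close> as a complete quotient.\<close>

lemma not_CFF_1_plus_sqrt3:
  assumes ab: "a = 2" "b = 2"
  shows "\<not> CFF \<beta>"
proof -
  define w :: "int list" where "w = [1,1,1,1,1,1,1,2,1,1,2,1,2,1,1,1,2,2]"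
  define t where "t = sqrt (12 :: real)"
  \<comment> \<open>the positive fixed point \<open>x = (p x + q) / (r x + s)\<close> of the matrix of \<open>w\<close>; \<open>\<surd>12\<close> is \<open>\<surd>(a\<^sup>2 + 4 b)\<close>\<close>
  define x where "x = (11055 + 5432 * t) / 18471"
  have w: "w \<noteq> []" "set w \<subseteq> {1, 2}" by (simp_all add: w_def)
  have M: "cf_matrix w = (29872, 12553, 18471, 7762)" by (simp add: w_def)
  have t: "t * t = 12" "3.4 < t" "t < 3.5" unfolding t_def
    by (simp, rule real_less_rsqrt, simp add: power2_eq_square,
        rule real_less_lsqrt, simp_all add: power2_eq_square)
  have x32: "3 / 2 < x" "x < 2" using t by (simp_all add: x_def)
  have "(11055 + 5432 * t) * (11055 + 5432 * t) = 22110 * (11055 + 5432 * t) + 12553 * 18471"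
    using t(1) by (simp add: algebra_simps)
  then have xx: "18471 * (x * x) = 22110 * x + 12553" by (simp add: x_def)
  have fp: "cf_prepend w x = x"
  proof -
    have "29872 * x + 12553 = x * (18471 * x + 7762)" using xx by (simp add: algebra_simps)
    moreover have "0 < 18471 * x + 7762" "cf_prepend w x = (29872 * x + 12553) / (18471 * x + 7762)"
      using cf_prepend_cf_matrix[OF _ w(2) M, of x] x32 by simp_all
    ultimately show ?thesis by simp
  qed
  have x1: "1 < x" using x32 by simp
  note periodic = periodic_cf12[OF x1 fp w]
  have s3: "t = 2 * sqrt 3" using real_sqrt_mult[of 4 3] by (simp add: t_def)
  have \<beta>: "\<beta> = 1 + sqrt 3" using closed_form s3 by (simp add: ab t_def)
  show ?thesis
  proof (rule not_CFF_if_cf12[OF _ periodic(1,2)])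
    have "x = of_rat (11055 / 18471) + of_rat (5432 / 18471) * sqrt (of_int (a\<^sup>2 + 4 * b))"
      by (simp add: x_def ab t_def of_rat_divide add_divide_distrib)
    then show "x \<in> rat_adjoin \<beta>" unfolding rat_adjoin_sqrt by blast
    fix n
    show "regular_cf_quotient x n \<noteq> \<beta>"
    proof
      assume "regular_cf_quotient x n = \<beta>"
      then obtain v where "set v \<subseteq> {1, 2}" "cf_prepend v x = 1 + sqrt 3"
        using periodic(3)[of n] \<beta> by auto
      then have "x = 1 + sqrt 3 \<or> x = (1 + sqrt 3) / 2"
        using cf_prepend_eq_1_plus_sqrt3[OF x1, of v] by simp
      then show False using x32 t s3 by auto
    qed
  qed (simp add: \<beta>)
qed

lemma not_CFF_sqrt21:
  assumes ab: "a = 1" "b = 5"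
  shows "\<not> CFF \<beta>"
proof -
  define w :: "int list" where "w = [1,1,1,2,1,2,1,2,2,2,1,1,2,2]"
  define t where "t = sqrt (21 :: real)"
  define x where "x = (117 + 44 * t) / 202"
  have w: "w \<noteq> []" "set w \<subseteq> {1, 2}" by (simp_all add: w_def)
  have M: "cf_matrix w = (9559, 4005, 6060, 2539)" by (simp add: w_def)
  have t: "t * t = 21" "4.5 < t" unfolding t_def
    by (simp, rule real_less_rsqrt, simp add: power2_eq_square)
  have x1: "1 < x" using t by (simp add: x_def)
  have "(117 + 44 * t) * (117 + 44 * t) = 234 * (117 + 44 * t) + 26967"
    using t(1) by (simp add: algebra_simps)
  then have xx: "6060 * (x * x) = 7020 * x + 4005" by (simp add: x_def)
  have fp: "cf_prepend w x = x"
  proof -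
    have "9559 * x + 4005 = x * (6060 * x + 2539)" using xx by (simp add: algebra_simps)
    moreover have "0 < 6060 * x + 2539" "cf_prepend w x = (9559 * x + 4005) / (6060 * x + 2539)"
      using cf_prepend_cf_matrix[OF _ w(2) M, of x] x1 by simp_all
    ultimately show ?thesis by simp
  qed
  note periodic = periodic_cf12[OF x1 fp w]
  have \<beta>: "\<beta> = (1 + t) / 2" using closed_form by (simp add: ab t_def)
  have "sqrt 3 < 1.74" by (rule real_less_lsqrt) (simp_all add: power2_eq_square)
  then have lt: "1 + sqrt 3 < \<beta>" using t \<beta> by simp
  show ?thesis
  proof (rule not_CFF_if_cf12[OF _ periodic(1,2)])
    have "x = of_rat (117 / 202) + of_rat (44 / 202) * sqrt (of_int (a\<^sup>2 + 4 * b))"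
      by (simp add: x_def ab t_def of_rat_divide add_divide_distrib)
    then show "x \<in> rat_adjoin \<beta>" unfolding rat_adjoin_sqrt by blast
  qed (use lt in simp_all)
qed

lemma not_CFF_golden_square:
  assumes ab: "a = 3" "b = - 1"
  shows "\<not> CFF \<beta>"
proof -
  define x where "x = (1 + sqrt (5 :: real)) / 2"
  have s: "sqrt (5 :: real) * sqrt 5 = 5" "1 < sqrt (5 :: real)" by (simp_all add: real_less_rsqrt)
  have \<beta>: "\<beta> = x + 1" using closed_form by (simp add: ab x_def field_simps)
  have x1: "1 < x" using s by (simp add: x_def)
  have "x * x = x + 1" using s(1) by (simp add: x_def field_simps)
  then have eq: "x = 1 + 1 / x" using x1 by (simp add: field_simps)
  note fixed = cf12_of_closed_set[of "{x}" x]
  have q: "regular_cf_quotient x n = x" "infinite_regular_cf x" for n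
    using fixed(1,2) eq x1 by auto
  have "x = of_rat (1 / 2) + of_rat (1 / 2) * sqrt (of_int (a\<^sup>2 + 4 * b))"
    by (simp add: x_def ab of_rat_divide add_divide_distrib)
  then have "x \<in> rat_adjoin \<beta>" unfolding rat_adjoin_sqrt by blast
  then show ?thesis unfolding CFF_iff using x1 q \<beta> by auto
qed

section \<open>Quadratic Perron numbers below 3\<close>

text \<open>With \<open>D = a\<^sup>2 + 4 b\<close>, the condition \<open>\<beta> < 3\<close> reads \<open>\<surd>D < 6 - a\<close>; the pairs left out below have \<open>D\<close> a square.\<close>

lemma coefficients_if_less_3:
  assumes "\<beta> < 3"
  shows "(a, b) \<in> {(1, 1), (1, 3), (1, 4), (1, 5), (2, 1), (2, 2), (3, - 1)}"
proof -
  have s: "sqrt (of_int (a\<^sup>2 + 4 * b)) < of_int (6 - a)" using sqrt_discriminant assms by simp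
  have "0 < real_of_int (6 - a)"
    using s sqrt_discriminant by linarith
  then have a: "a \<le> 5" by simp
  have "0 \<le> real_of_int (a\<^sup>2 + 4 * b)" using discriminant_pos by (simp only: of_int_0_le_iff)
  then have "real_of_int (a\<^sup>2 + 4 * b) = (sqrt (of_int (a\<^sup>2 + 4 * b)))\<^sup>2" by (simp only: real_sqrt_pow2)
  also have "\<dots> < (of_int (6 - a))\<^sup>2"
    using s \<open>0 \<le> real_of_int (a\<^sup>2 + 4 * b)\<close> by (intro power_strict_mono) (simp_all only: real_sqrt_ge_zero zero_less_numeral)
  finally have "a\<^sup>2 + 4 * b < (6 - a)\<^sup>2" by (simp only: of_int_less_iff flip: of_int_power)
  then have up: "b < 9 - 3 * a" by (simp add: power2_eq_square algebra_simps)
  have "sqrt 9 = (3 :: real)" by (rule real_sqrt_unique) auto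
  then have square: "a\<^sup>2 + 4 * b \<notin> {1, 4, 9}"
    using sqrt_discriminant_irrational by (auto simp del: of_int_add of_int_mult of_int_power)
  have "a = 1 \<or> a = 2 \<or> a = 3 \<or> a = 4 \<or> a = 5" using a a_pos by linarith
  then show ?thesis
  proof (elim disjE)
    assume "a = 1"
    then show ?thesis using up discriminant_pos square by (simp; presburger)
  next
    assume "a = 2"
    then show ?thesis using up discriminant_pos square by (simp; presburger)
  next
    assume "a = 3"
    then show ?thesis using up discriminant_pos square by (simp; presburger)
  next
    assume "a = 4"
    then show ?thesis using up discriminant_pos by simp
  next
    assume "a = 5"
    then show ?thesis using up discriminant_pos by simp
  qed
qed

end

lemma quadratic_Perron_CFF_listed:
  assumes "\<beta> \<in> {(1 + sqrt 5) / 2, 1 + sqrt 2, (1 + sqrt 13) / 2, (1 + sqrt 17) / 2}"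
  shows "quadratic_Perron \<beta>" "\<beta> < 3" "CFF \<beta>"
proof -
  have s8: "sqrt 8 = 2 * sqrt 2" using real_sqrt_mult[of 4 2] by simp
  have \<beta>1: "1 < \<beta>" using assms by (elim insertE emptyE; hypsubst) simp_all
  from assms obtain a b where ab: "perron_quadratic \<beta> a b" "(a, b) \<in> {(1, 1), (2, 1), (1, 3), (1, 4)}"
  proof (elim insertE emptyE)
    assume "\<beta> = (1 + sqrt 5) / 2"
    then show ?thesis
      by (intro that[of 1 1] perron_quadraticI) (use sqrt_irrationals \<beta>1 in auto)
  next
    assume "\<beta> = 1 + sqrt 2"
    then show ?thesis
      by (intro that[of 2 1] perron_quadraticI) (use sqrt_irrationals \<beta>1 s8 in auto)
  next
    assume "\<beta> = (1 + sqrt 13) / 2"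
    then show ?thesis
      by (intro that[of 1 3] perron_quadraticI) (use sqrt_irrationals \<beta>1 in auto)
  next
    assume "\<beta> = (1 + sqrt 17) / 2"
    then show ?thesis
      by (intro that[of 1 4] perron_quadraticI) (use sqrt_irrationals \<beta>1 in auto)
  qed
  interpret perron_quadratic \<beta> a b by fact
  show "quadratic_Perron \<beta>" by (rule is_quadratic_Perron)
  show "CFF \<beta>" using ab(2) by (rule CFF_of_listed)
  have "sqrt 5 < (5 :: real)" "sqrt 2 < (2 :: real)" "sqrt 13 < (5 :: real)" "sqrt 17 < (5 :: real)"
    by (rule real_less_lsqrt; simp)+
  then show "\<beta> < 3" using assms by auto
qed

lemma CFF_less_3_imp_listed:
  assumes "quadratic_Perron \<beta>" "\<beta> < 3" "CFF \<beta>"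
  shows "\<beta> \<in> {(1 + sqrt 5) / 2, 1 + sqrt 2, (1 + sqrt 13) / 2, (1 + sqrt 17) / 2}"
proof -
  obtain a b where "perron_quadratic \<beta> a b"
    using quadratic_Perron_imp_perron_quadratic[OF assms(1)] .
  then interpret perron_quadratic \<beta> a b .
  have s8: "sqrt 8 = 2 * sqrt 2" using real_sqrt_mult[of 4 2] by simp
  have "(a, b) \<in> {(1, 1), (2, 1), (1, 3), (1, 4)}"
    using coefficients_if_less_3[OF assms(2)] not_CFF_1_plus_sqrt3 not_CFF_sqrt21 not_CFF_golden_square assms(3)
    by auto
  then show ?thesis using closed_form s8 by auto
qed

theorem corollary6p7:
  "{\<beta>. quadratic_Perron \<beta> \<and> \<beta> < 3 \<and> CFF \<beta>} =
     {(1 + sqrt 5) / 2, 1 + sqrt 2, (1 + sqrt 13) / 2, (1 + sqrt 17) / 2} \<and>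
   (Mercat_conjecture \<longrightarrow>
     {\<beta>. quadratic_Perron \<beta> \<and> CFF \<beta>} =
       {(1 + sqrt 5) / 2, 1 + sqrt 2, (1 + sqrt 13) / 2, (1 + sqrt 17) / 2})"
proof -
  have "\<beta> < 3" if \<beta>: "quadratic_Perron \<beta>" "CFF \<beta>" Mercat_conjecture for \<beta>
  proof (rule ccontr)
    assume "\<not> \<beta> < 3"
    obtain a b where "perron_quadratic \<beta> a b"
      using quadratic_Perron_imp_perron_quadratic[OF \<beta>(1)] .
    then show False
      using perron_quadratic.not_CFF_if_Mercat[OF _ \<beta>(3)] \<beta>(2) \<open>\<not> \<beta> < 3\<close> by simp
  qed
  then show ?thesis using quadratic_Perron_CFF_listed CFF_less_3_imp_listed by blast
qed

end
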